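(* Let $G$ be a prime tournament. Then $G$ is $U_5$-free if and only if either $G$ is isomorphic to $T_n$ for some odd $n \ge 1$, or $V(G)$ can be partitioned into sets $X$, $Y$, $Z$ (some possibly empty) such that $X \cup Y$, $Y \cup Z$, and $Z \cup X$ are each transitive.
   Context: A tournament is a finite loopless directed graph in which for any two distinct vertices $u,v$ there is exactly one edge between them; write $u \rightarrow v$ for the edge from $u$ to $v$. A subtournament is a tournament induced on a subset of vertices. For tournaments $G,H$, $G$ is $H$-free if no subtournament of $G$ is isomorphic to $H$. A set $S \subseteq V(G)$ is transitive if the induced subtournament has no cyclic triangle (three vertices $a\rightarrow b\rightarrow c\rightarrow a$). A homogeneous set of $G$ is a set $X \subseteq V(G)$ such that every $v \in V(G)\setminus X$ satisfies either $v \rightarrow x$ for all $x \in X$ or $x \rightarrow v$ for all $x \in X$; it is nontrivial if $1<|X|<|V(G)|$. $G$ is prime if it has no nontrivial homogeneous set. For odd $n\ge1$, $T_n$ is the tournament on $v_1,\dots,v_n$ with $v_i \rightarrow v_j$ iff $j-i \equiv 1,2,\dots,(n-1)/2 \pmod n$. $U_5$ is the tournament on $v_1,\dots,v_5$ with $v_2 \rightarrow v_1$, and $v_i \rightarrow v_j$ whenever $j-i\equiv 1,2 \pmod 5$ and $\{i,j\}\neq\{1,2\}$. *)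

theory Defs
  imports "Graph_Theory.Digraph_Isomorphism" "HOL-Number_Theory.Cong"
begin

text \<open>The locale \<open>digraph\<close> already gives finiteness, no loops and no parallel arcs. The null
  tournament is allowed.\<close>

locale tournament = digraph G for G :: "('a, 'b) pre_digraph" (structure) +
  assumes exactly_one_arc:
    "\<And>u v. u \<in> verts G \<Longrightarrow> v \<in> verts G \<Longrightarrow> u \<noteq> v \<Longrightarrow> (u \<rightarrow> v) \<noteq> (v \<rightarrow> u)"

definition is_free :: "('a, 'b) pre_digraph \<Rightarrow> ('c, 'd) pre_digraph \<Rightarrow> bool" where
  "is_free H G \<longleftrightarrow> \<not> (\<exists>S \<subseteq> verts G. digraph_iso (G \<restriction> S) H)"

definition transitive_set :: "('a, 'b) pre_digraph \<Rightarrow> 'a set \<Rightarrow> bool" where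
  "transitive_set G S \<longleftrightarrow> S \<subseteq> verts G \<and>
     \<not> (\<exists>a\<in>S. \<exists>b\<in>S. \<exists>c\<in>S. (a \<rightarrow>\<^bsub>G\<^esub> b) \<and> (b \<rightarrow>\<^bsub>G\<^esub> c) \<and> (c \<rightarrow>\<^bsub>G\<^esub> a))"

definition homogeneous_set :: "('a, 'b) pre_digraph \<Rightarrow> 'a set \<Rightarrow> bool" where
  "homogeneous_set G X \<longleftrightarrow> X \<subseteq> verts G \<and>
     (\<forall>v \<in> verts G - X. (\<forall>x\<in>X. v \<rightarrow>\<^bsub>G\<^esub> x) \<or> (\<forall>x\<in>X. x \<rightarrow>\<^bsub>G\<^esub> v))"

locale prime_tournament = tournament G for G :: "('a, 'b) pre_digraph" (structure) +
  assumes no_nontrivial_homogeneous_set: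
    "\<not> (\<exists>X. homogeneous_set G X \<and> 1 < card X \<and> card X < card (verts G))"

text \<open>The index \<open>i\<close> stands for the vertex \<open>v\<^sub>i\<close>. Only odd \<open>n\<close> are meaningful in \<open>T_tournament n\<close>.\<close>

definition T_tournament :: "nat \<Rightarrow> (nat, nat \<times> nat) pre_digraph" where
  "T_tournament n = with_proj
     \<lparr> pverts = {1..n},
       parcs = {(i, j). i \<in> {1..n} \<and> j \<in> {1..n} \<and>
         (\<exists>k\<in>{1..(n - 1) div 2}. [int j - int i = int k] (mod int n))} \<rparr>"

definition U5 :: "(nat, nat \<times> nat) pre_digraph" where
  "U5 = with_proj
     \<lparr> pverts = {1..5},
       parcs = insert (2, 1) {(i, j). i \<in> {1..5} \<and> j \<in> {1..5} \<and> {i, j} \<noteq> {1, 2} \<and>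
         (\<exists>k\<in>{1, 2}. [int j - int i = k] (mod 5))} \<rparr>"

end

theory Submission
  imports Defs
begin

text \<open>
  That \<open>T\<^sub>n\<close> and the three-part tournaments avoid \<open>U\<^sub>5\<close> is direct: \<open>U\<^sub>5\<close> has a vertex dominating a
  cyclic triangle, and its cyclic triangles cannot all be three-coloured. For the converse let \<open>G\<close> be
  prime and \<open>U\<^sub>5\<close>-free.

  If \<open>G\<close> contains \<open>T\<^sub>5\<close>, then each further vertex is a twin of a vertex of that copy, up to its arc to
  that vertex: the only alternatives, sources and sinks of the copy, would persist under replacing
  vertices by twins and hence contradict primality. It follows that no neighbourhood
  contains a cyclic triangle, and a prime tournament with this property is read off as \<open>T\<^sub>n\<close> around any
  vertex.

  Otherwise take a maximal prime subtournament \<open>W\<close> with a rainbow colouring, that is, a colouring by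
  three colours giving three different colours to each cyclic triangle; its colour classes are the parts
  \<open>X\<close>, \<open>Y\<close>, \<open>Z\<close>. The colouring extends to any one further vertex \<open>x\<close>, so by maximality \<open>x\<close> either
  relates uniformly to \<open>W\<close> or is a twin of a vertex of \<open>W\<close>. If \<open>W \<noteq> G\<close>, two such vertices
  together give a larger prime subtournament (Ehrenfeucht--Rozenberg), and it is coloured as well.

  The basic tool is \<open>escape\<close>: a cyclic triangle inside a proper subset \<open>P\<close> of a prime tournament leads to
  a cyclic triangle inside \<open>P\<close> that is split by a vertex outside \<open>P\<close>.
\<close>

section \<open>Prime and strongly connected tournaments\<close>

text \<open>Any two vertices of \<open>T\<^sub>5\<close> lie on a common cyclic triangle, so a
  rainbow colouring of \<open>T\<^sub>5\<close> would need five colours; this is why its presence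
  decides the case. The parts are replaced by a colouring because the condition on their unions then
  becomes a condition on single cyclic triangles and can be followed while vertices are added. The
  obstacle in the second case is that a colouring is known to extend by one vertex only over a prime
  set, whereas one added vertex may destroy primality, by being uniform or a twin. Two vertices must
  then be added and coloured together, and the delicate triangles are those through both of them.
  With two twins such triangles arise because the arc between the new vertices is opposite to the
  arc between the vertices they copy, which explains the recurring picture of a flipped arc with
  vertices before, between and after it. Both \<open>U\<^sub>5\<close> and \<open>T\<^sub>5\<close>
  are isomorphic to their reverses, so each statement proved for one orientation is available for
  the other by reversing \<open>E\<close>.\<close>

abbreviation cyc :: "('a \<Rightarrow> 'a \<Rightarrow> bool) \<Rightarrow> 'a \<Rightarrow> 'a \<Rightarrow> 'a \<Rightarrow> bool" where
  "cyc E a b c \<equiv> E a b \<and> E b c \<and> E c a"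

definition uniform_to :: "('a \<Rightarrow> 'a \<Rightarrow> bool) \<Rightarrow> 'a \<Rightarrow> 'a set \<Rightarrow> bool" where
  "uniform_to E v I \<longleftrightarrow> (\<forall>x\<in>I. E v x) \<or> (\<forall>x\<in>I. E x v)"

definition prime_on :: "('a \<Rightarrow> 'a \<Rightarrow> bool) \<Rightarrow> 'a set \<Rightarrow> bool" where
  "prime_on E W \<longleftrightarrow> finite W \<and>
     (\<forall>I\<subseteq>W. (\<forall>v\<in>W - I. uniform_to E v I) \<longrightarrow> card I \<le> 1 \<or> I = W)"

text \<open>Strong connectivity in terms of cuts instead of paths: later arguments build a set by
  hand and ask for an arc that leaves it.\<close>

definition strong_on :: "('a \<Rightarrow> 'a \<Rightarrow> bool) \<Rightarrow> 'a set \<Rightarrow> bool" where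
  "strong_on E M \<longleftrightarrow> (\<forall>S\<subseteq>M. S \<noteq> {} \<longrightarrow> S \<noteq> M \<longrightarrow> (\<exists>a\<in>S. \<exists>b\<in>M - S. E a b))"

lemma strong_onD:
  assumes "strong_on E M" "S \<subseteq> M" "s \<in> S" "z \<in> M" "z \<notin> S"
  obtains a b where "a \<in> S" "b \<in> M" "b \<notin> S" "E a b"
proof -
  have "S \<noteq> {}" "S \<noteq> M" using assms by auto
  then have "\<exists>a\<in>S. \<exists>b\<in>M - S. E a b" using assms unfolding strong_on_def by simp
  then show thesis using that by blast
qed

lemma uniform_to_conv: "uniform_to (\<lambda>x y. E y x) v I \<longleftrightarrow> uniform_to E v I"
  unfolding uniform_to_def by (simp add: disj_commute)

lemma prime_on_conv: "prime_on (\<lambda>x y. E y x) W \<longleftrightarrow> prime_on E W"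
  unfolding prime_on_def by (simp add: uniform_to_conv[of E])

locale tournament_rel =
  fixes E :: "'a \<Rightarrow> 'a \<Rightarrow> bool"
  assumes asym: "E x y \<Longrightarrow> \<not> E y x"
    and total: "x \<noteq> y \<Longrightarrow> E x y \<or> E y x"
begin

lemma irrefl [simp]: "\<not> E x x"
  using asym by blast

lemma prime_onD:
  assumes "prime_on E W" "I \<subseteq> W" "a \<in> I" "b \<in> I" "a \<noteq> b" "z \<in> W" "z \<notin> I"
  obtains v x y where "v \<in> W" "v \<notin> I" "x \<in> I" "y \<in> I" "E v x" "E y v"
proof -
  have "finite I" using assms finite_subset unfolding prime_on_def by blast
  then have "\<not> card I \<le> 1" using assms(3-5) card_le_Suc0_iff_eq[of I] by auto
  then obtain v where v: "v \<in> W" "v \<notin> I" "\<not> uniform_to E v I"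
    using assms unfolding prime_on_def by blast
  then obtain x y where "x \<in> I" "y \<in> I" "\<not> E y v" "\<not> E v x"
    unfolding uniform_to_def by blast
  then show ?thesis using that[OF v(1,2), of y x] v total by metis
qed

lemma prime_onI:
  assumes "finite W"
    and "\<And>I a b z. I \<subseteq> W \<Longrightarrow> a \<in> I \<Longrightarrow> b \<in> I \<Longrightarrow> a \<noteq> b \<Longrightarrow> z \<in> W \<Longrightarrow> z \<notin> I \<Longrightarrow>
      (\<And>v x y. v \<in> W \<Longrightarrow> v \<notin> I \<Longrightarrow> x \<in> I \<Longrightarrow> y \<in> I \<Longrightarrow> E v x \<Longrightarrow> E v y) \<Longrightarrow> False"
  shows "prime_on E W"
  unfolding prime_on_def
proof (intro conjI allI impI assms(1))
  fix I assume I: "I \<subseteq> W" "\<forall>v\<in>W - I. uniform_to E v I"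
  have fin: "finite I" using I(1) assms(1) finite_subset by blast
  have "E v y" if "v \<in> W" "v \<notin> I" "x \<in> I" "y \<in> I" "E v x" for v x y
    using I(2) that asym unfolding uniform_to_def by blast
  then have "\<not> (\<exists>a\<in>I. \<exists>b\<in>I. a \<noteq> b) \<or> \<not> (\<exists>z\<in>W. z \<notin> I)"
    using assms(2)[OF I(1)] by blast
  then show "card I \<le> 1 \<or> I = W"
    using I(1) card_le_Suc0_iff_eq[OF fin] by auto
qed

text \<open>If no arc leaves \<open>S\<close>, then \<open>S\<close> and its complement are both
  homogeneous, hence have at most one vertex each. The bound on the size matters: a single arc is
  prime but not strong.\<close>

lemma prime_strong:
  assumes "prime_on E W" "3 \<le> card W"
  shows "strong_on E W"
  unfolding strong_on_def
proof (intro allI impI, rule ccontr)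
  fix S assume S: "S \<subseteq> W" "S \<noteq> {}" "S \<noteq> W" and no: "\<not> (\<exists>a\<in>S. \<exists>b\<in>W - S. E a b)"
  have fin: "finite W" using assms(1) unfolding prime_on_def by blast
  have un: "E b a" if "a \<in> S" "b \<in> W - S" for a b
    using no that total by (metis DiffD2)
  have 1: "card S \<le> 1"
    using assms(1) S un unfolding prime_on_def uniform_to_def by blast
  have "\<forall>v\<in>W - (W - S). uniform_to E v (W - S)" using un unfolding uniform_to_def by blast
  then have 2: "card (W - S) \<le> 1"
    using assms(1) S unfolding prime_on_def by (metis Diff_subset double_diff Diff_cancel subset_refl)
  have "card W = card S + card (W - S)"
    using fin S(1) by (metis card_Un_disjoint Diff_disjoint finite_subset finite_Diff Diff_partition)
  then show False using 1 2 assms(2) by simp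
qed

text \<open>Two-step paths through both sides of the partition would be transitive if no cyclic triangle
  crossed it, so the set \<open>S\<close> below would be closed under out-neighbours.\<close>

lemma crossing_triangle:
  assumes M: "strong_on E M" and A: "A \<subseteq> M" "s \<in> A" "z \<in> M" "z \<notin> A"
  obtains a b c where "cyc E a b c" "a \<in> A" "b \<in> M" "b \<notin> A" "c \<in> M"
proof -
  have "\<exists>a b c. cyc E a b c \<and> a \<in> A \<and> b \<in> M \<and> b \<notin> A \<and> c \<in> M"
  proof (rule ccontr)
    assume "\<not> ?thesis"
    then have no: "\<not> cyc E a b c" if "a \<in> A" "b \<in> M" "b \<notin> A" "c \<in> M" for a b c
      using that by blast
    have tr: "E u w" if "E u v" "E v w" "{u,v,w} \<subseteq> M" "\<not> {u,v,w} \<subseteq> A" "{u,v,w} \<inter> A \<noteq> {}" for u v w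
    proof (rule ccontr)
      assume "\<not> E u w"
      then have "E w u" using that(1,2) total asym by metis
      then have "cyc E u v w" "cyc E v w u" "cyc E w u v" using that by auto
      then show False using no[of u v w] no[of v w u] no[of w u v] that(3-5) by auto
    qed
    obtain a b where ab: "a \<in> A" "b \<in> M" "b \<notin> A" "E a b"
      using strong_onD[OF M A] by blast
    define S where "S = {w \<in> M - A. E a w} \<union> {w \<in> A. \<exists>b'\<in>M - A. E a b' \<and> E b' w}"
    have "S \<subseteq> M" "b \<in> S" using A ab S_def by auto
    moreover have "a \<notin> S" using asym ab unfolding S_def by auto
    moreover have "a \<in> M" using ab A by auto
    ultimately obtain v w where vw: "v \<in> S" "w \<in> M" "w \<notin> S" "E v w"
      using strong_onD[OF M] by metis
    have aM: "a \<in> M" "v \<in> M" using ab A vw \<open>S \<subseteq> M\<close> by auto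
    show False
    proof (cases "v \<in> A")
      case False
      then have "E a v" using vw S_def by auto
      then have "E a w" using tr[of a v w] vw aM ab False by auto
      then show False using vw False aM \<open>E a v\<close> unfolding S_def by auto
    next
      case True
      then obtain b' where b': "b' \<in> M" "b' \<notin> A" "E a b'" "E b' v" using vw S_def by auto
      show False
      proof (cases "w \<in> A")
        case True
        then have "E b' w" using tr[of b' v w] b' vw aM \<open>v \<in> A\<close> by auto
        then show False using True vw b' unfolding S_def by auto
      next
        case False
        have "E a v" using tr[of a b' v] b' aM ab by auto
        then have "E a w" using tr[of a v w] vw aM ab False by auto
        then show False using False vw unfolding S_def by auto
      qed
    qed
  qed
  then show thesis using that by blast
qed

lemma strong_insert:
  assumes "strong_on E M" "E x w" "E w y" "x \<in> M" "y \<in> M"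
  shows "strong_on E (insert w M)"
  unfolding strong_on_def
proof (intro allI impI)
  fix S assume S: "S \<subseteq> insert w M" "S \<noteq> {}" "S \<noteq> insert w M"
  show "\<exists>a\<in>S. \<exists>b\<in>insert w M - S. E a b"
  proof (cases "S \<inter> M = {} \<or> S \<inter> M = M")
    case False
    then obtain a b where "a \<in> S \<inter> M" "b \<in> M - S \<inter> M" "E a b"
      using assms(1) unfolding strong_on_def by (metis inf_le2)
    then show ?thesis by auto
  next
    case True
    then show ?thesis
    proof
      assume "S \<inter> M = {}"
      then have "w \<in> S" "y \<notin> S" using S assms by auto
      then show ?thesis using assms by auto
    next
      assume "S \<inter> M = M"
      then have "x \<in> S" "w \<notin> S" using S assms by auto
      then show ?thesis using assms by auto
    qed
  qed
qed

lemma strong_triangle: "cyc E a b c \<Longrightarrow> strong_on E {a, b, c}"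
  unfolding strong_on_def
proof (intro allI impI)
  fix S assume "cyc E a b c" "S \<subseteq> {a,b,c}" "S \<noteq> {}" "S \<noteq> {a,b,c}"
  then show "\<exists>x\<in>S. \<exists>y\<in>{a,b,c} - S. E x y"
    by (cases "a \<in> S"; cases "b \<in> S"; cases "c \<in> S"; auto)
qed

text \<open>A maximal strong subset of \<open>P\<close> is not homogeneous, and a vertex splitting it must lie
  outside \<open>P\<close>.\<close>

lemma escape:
  assumes "prime_on E W" "cyc E a0 b0 c0" "{a0, b0, c0} \<subseteq> P" "P \<subseteq> W" "q \<in> W" "q \<notin> P"
  obtains (one) a b c w where "cyc E a b c" "a \<in> P" "b \<in> P" "c \<in> P" "w \<in> W" "w \<notin> P"
      "E w a" "E b w" "E c w"
    | (two) a b c w where "cyc E a b c" "a \<in> P" "b \<in> P" "c \<in> P" "w \<in> W" "w \<notin> P"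
      "E a w" "E w b" "E w c"
proof -
  have fin: "finite W" using assms(1) unfolding prime_on_def by blast
  then have finP: "finite P" using assms(4) finite_subset by blast
  define \<M> where "\<M> = {M. M \<subseteq> P \<and> strong_on E M \<and> {a0, b0, c0} \<subseteq> M}"
  have "finite \<M>" unfolding \<M>_def using finP by simp
  moreover have "{a0, b0, c0} \<in> \<M>" using assms(3) strong_triangle[OF assms(2)] \<M>_def by auto
  ultimately obtain M where M: "M \<in> \<M>" "\<And>N. N \<in> \<M> \<Longrightarrow> M \<subseteq> N \<Longrightarrow> N = M"
    using finite_has_maximal2 by metis
  then have M': "M \<subseteq> P" "strong_on E M" "{a0, b0, c0} \<subseteq> M" unfolding \<M>_def by auto
  have "a0 \<noteq> b0" using assms(2) by auto
  then obtain w x y where w: "w \<in> W" "w \<notin> M" "x \<in> M" "y \<in> M" "E w x" "E y w"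
    using prime_onD[OF assms(1), of M a0 b0 q] M' assms by (metis (no_types) insert_subset subset_iff)
  have "w \<notin> P"
  proof
    assume "w \<in> P"
    then have "insert w M \<in> \<M>" using strong_insert[OF M'(2) w(6,5,4,3)] M' \<M>_def by auto
    then show False using M(2) w(2) by blast
  qed
  have wM: "E w t \<or> E t w" if "t \<in> M" for t using w(2) total that by metis
  \<comment> \<open>The out-neighbours of \<open>w\<close> form a nonempty proper part of
    \<open>M\<close>, and a cyclic triangle crossing this partition is precisely one split by
    \<open>w\<close>. Rotation then puts the vertex whose arc to \<open>w\<close> differs from the
    other two in front.\<close>
  obtain a b c where t: "cyc E a b c" "a \<in> {t\<in>M. E w t}" "b \<in> M" "b \<notin> {t\<in>M. E w t}" "c \<in> M"
    by (rule crossing_triangle[OF M'(2), of "{t\<in>M. E w t}" x y]) (use w asym in auto)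
  have 1: "E w a" "E b w" using t wM by auto
  have P: "a \<in> P" "b \<in> P" "c \<in> P" using t M' by auto
  show thesis
  proof (cases "E w c")
    case True
    show thesis by (rule two[of b c a w]) (use t P 1 w True \<open>w \<notin> P\<close> in auto)
  next
    case False
    then have "E c w" using wM t by auto
    then show thesis using one[of a b c w] t P 1 w \<open>w \<notin> P\<close> by auto
  qed
qed

lemma acyclic_sink:
  assumes "finite S" "S \<noteq> {}" and no: "\<And>a b c. a \<in> S \<Longrightarrow> b \<in> S \<Longrightarrow> c \<in> S \<Longrightarrow> \<not> cyc E a b c"
  obtains s where "s \<in> S" "\<And>t. t \<in> S \<Longrightarrow> t \<noteq> s \<Longrightarrow> E t s"
proof -
  have "\<exists>s\<in>S. \<forall>t\<in>S. t \<noteq> s \<longrightarrow> E t s"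
    using assms
  proof (induction S rule: finite_ne_induct)
    case (singleton x)
    then show ?case by auto
  next
    case (insert x F)
    then obtain s where s: "s \<in> F" "\<forall>t\<in>F. t \<noteq> s \<longrightarrow> E t s" by blast
    show ?case
    proof (cases "E x s")
      case True
      then show ?thesis using s by auto
    next
      case False
      then have "E s x" using s insert total by metis
      moreover have "E t x" if "t \<in> F" for t
        using that s insert.prems[of t s x] \<open>E s x\<close> insert.hyps total[of x t]
        by (cases "t = s") auto
      ultimately show ?thesis by auto
    qed
  qed
  then show thesis using that by blast
qed

end

text \<open>\<open>U\<^sub>5\<close> is a cyclic triangle \<open>a b c\<close> dominated by \<open>v\<close>, with \<open>w \<rightarrow> v\<close> and exactly one arc, to \<open>a\<close>, from
  \<open>w\<close> to the triangle. It is self-dual; \<open>no_U5'\<close> is the dual reading.\<close>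

locale U5_free = tournament_rel +
  assumes no_U5: "\<lbrakk>E v a; E v b; E v c; E a b; E b c; E c a; E w v; E w a; E b w; E c w\<rbrakk> \<Longrightarrow> False"
begin

lemma no_U5': "\<lbrakk>E a v; E b v; E c v; E a b; E b c; E c a; E v w; E a w; E w b; E w c\<rbrakk> \<Longrightarrow> False"
  using no_U5[of a v w b c] by blast

lemma conv: "U5_free (\<lambda>x y. E y x)"
proof
  show "E v u \<Longrightarrow> \<not> E u v" for u v using asym by blast
  show "u \<noteq> v \<Longrightarrow> E v u \<or> E u v" for u v using total by blast
  show "\<lbrakk>E a v; E b v; E c v; E b a; E c b; E a c; E v w; E a w; E w b; E w c\<rbrakk> \<Longrightarrow> False"
    for a b c v w using no_U5'[of a v c b w] by blast
qed

end

section \<open>Extending a rainbow colouring by one vertex\<close>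

datatype colour = Red | Green | Blue

lemma colour_cases:
  fixes p q r s :: colour
  shows "p \<noteq> q \<Longrightarrow> q \<noteq> r \<Longrightarrow> p \<noteq> r \<Longrightarrow> s = p \<or> s = q \<or> s = r"
  by (cases p; cases q; cases r; cases s; simp)

text \<open>Only the first two vertices are compared; the rotations of a cyclic triangle supply the
  other two inequalities.\<close>

definition rainbow :: "('a \<Rightarrow> 'a \<Rightarrow> bool) \<Rightarrow> 'a set \<Rightarrow> ('a \<Rightarrow> colour) \<Rightarrow> bool" where
  "rainbow E W c \<longleftrightarrow> (\<forall>a\<in>W. \<forall>b\<in>W. \<forall>d\<in>W. cyc E a b d \<longrightarrow> c a \<noteq> c b)"

lemma rainbowD:
  assumes "rainbow E W c" "E a b" "E b d" "E d a" "a \<in> W" "b \<in> W" "d \<in> W"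
  shows "c a \<noteq> c b \<and> c b \<noteq> c d \<and> c a \<noteq> c d"
  using assms unfolding rainbow_def by metis

lemma rainbow_conv: "rainbow (\<lambda>x y. E y x) W c \<longleftrightarrow> rainbow E W c"
  unfolding rainbow_def by metis

section \<open>No cyclic triangle through a new vertex has its other two vertices in one
  colour\<close>

context U5_free
begin

text \<open>\<open>escape\<close> moves to a triangle inside \<open>P\<close> that is split by some
  \<open>w\<close> outside \<open>P\<close>. Avoiding \<open>U\<^sub>5\<close> gives
  \<open>w\<close> one of the two arcs that define \<open>P\<close>; since \<open>w\<close> is not
  in \<open>P\<close>, the other arc is reversed, and \<open>w\<close>, \<open>q\<close>,
  \<open>x\<close> with two vertices of the triangle form \<open>U\<^sub>5\<close>.\<close>

lemma no_triangle_to_arc_to_triangle: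
  assumes W: "prime_on E W" "a \<in> W" "b \<in> W" "d \<in> W" "q \<in> W" and "cyc E a b d"
    and "E a q" "E b q" "E d q" "E q x" "E x a" "E x b" "E x d"
  shows False
proof -
  define P where "P = {m \<in> W. E m q \<and> E x m}"
  have P: "{a, b, d} \<subseteq> P" "P \<subseteq> W" "q \<notin> P" using assms P_def by auto
  have PD: "E m q" "E x m" if "m \<in> P" for m using that P_def by auto
  show False
  proof (rule escape[OF W(1) \<open>cyc E a b d\<close> P(1,2) \<open>q \<in> W\<close> P(3)])
    fix a b c w assume h: "cyc E a b c" "a \<in> P" "b \<in> P" "c \<in> P" "w \<in> W" "w \<notin> P"
      "E w a" "E b w" "E c w"
    have "w \<noteq> q" "w \<noteq> x" using h PD asym by blast+
    have "\<not> E w x" using no_U5[of x a b c w] h PD by blast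
    then have "E x w" using \<open>w \<noteq> x\<close> total by blast
    then have "\<not> E w q" using h P_def by blast
    then have "E q w" using \<open>w \<noteq> q\<close> total by blast
    then show False using no_U5[of x w a b q] h PD assms \<open>E x w\<close> by blast
  next
    fix a b c w assume h: "cyc E a b c" "a \<in> P" "b \<in> P" "c \<in> P" "w \<in> W" "w \<notin> P"
      "E a w" "E w b" "E w c"
    have "w \<noteq> q" "w \<noteq> x" using h PD asym by blast+
    have "\<not> E q w" using no_U5'[of a q b c w] h PD by blast
    then have "E w q" using \<open>w \<noteq> q\<close> total by blast
    then have "\<not> E x w" using h P_def by blast
    then have "E w x" using \<open>w \<noteq> x\<close> total by blast
    then show False using no_U5'[of w q c a x] h PD assms \<open>E w q\<close> by blast
  qed
qed

text \<open>If \<open>E w x\<close>, then \<open>s\<close> dominates the cyclic triangle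
  \<open>x p q\<close> and \<open>w\<close> completes it to \<open>U\<^sub>5\<close>; if
  \<open>E x w\<close>, then \<open>r\<close> dominates \<open>w s x\<close> and \<open>p\<close>
  completes it.\<close>

lemma two_mixing_vertices:
  assumes "cyc E p r s" "E p q" "E r q" "E s q" "E q w" "E q x"
    "E w s" "E p w" "E r w" "E x p" "E r x" "E s x"
  shows False
proof (cases "E w x")
  case True
  then show False using no_U5[of s x p q w] assms by blast
next
  case False
  moreover have "w \<noteq> x" using assms asym by blast
  ultimately have "E x w" using total by blast
  then show False using no_U5[of r w s x p] assms by blast
qed

text \<open>This is the shape that remains once \<open>p\<close> and \<open>q\<close> are
  consecutive in their colour. The in-neighbours of \<open>q\<close> contain the cyclic triangle
  \<open>p r s\<close>, so \<open>escape\<close> yields one split by an out-neighbour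
  \<open>w\<close> of \<open>q\<close>, and the colouring then fixes most arcs around
  \<open>w\<close>.\<close>

lemma monochromatic_config:
  assumes W: "prime_on E W" "rainbow E W c" "p \<in> W" "q \<in> W" "r \<in> W" "s \<in> W" and x: "x \<notin> W"
    and pq: "E x p" "E p q" "E q x" "c p = c q"
    and consec: "\<And>m. m \<in> W \<Longrightarrow> c m = c p \<Longrightarrow> E p m \<Longrightarrow> E m q \<Longrightarrow> False"
    and rs: "E s p" "E s q" "E p r" "E r q" "E r s"
  shows False
proof -
  note R = rainbowD[OF W(2)]
  have xW: "x \<noteq> m" if "m \<in> W" for m using x that by auto
  have col: "c p \<noteq> c r" "c r \<noteq> c s" "c p \<noteq> c s" using R[of p r s] rs W by auto
  have "\<not> (E x r \<and> E x s)"
    using no_triangle_to_arc_to_triangle[OF W(1), of p r s q x] W pq rs by blast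
  moreover have "\<not> (E x r \<and> E s x)" using no_U5[of s q x p r] pq rs by blast
  moreover have "\<not> (E r x \<and> E x s)" using no_U5[of r q x s p] pq rs by blast
  ultimately have rsx: "E r x" "E s x" using total xW[OF \<open>r \<in> W\<close>] xW[OF \<open>s \<in> W\<close>] by blast+
  define P where "P = {m \<in> W. E m q}"
  have P: "{p, r, s} \<subseteq> P" "P \<subseteq> W" "q \<notin> P" using W pq rs P_def by auto
  have PD: "E m q" "m \<in> W" if "m \<in> P" for m using that P_def by auto
  have prs: "cyc E p r s" using rs by auto
  show False
  proof (rule escape[OF W(1) prs P(1,2) \<open>q \<in> W\<close> P(3)])
    fix a b d w assume h: "cyc E a b d" "a \<in> P" "b \<in> P" "d \<in> P" "w \<in> W" "w \<notin> P"
      "E a w" "E w b" "E w d"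
    have "w \<noteq> q" using h PD asym by blast
    then have "E q w" using h P_def total by blast
    then show False using no_U5'[of a q b d w] h PD by blast
  next
    fix a b d w assume h: "cyc E a b d" "a \<in> P" "b \<in> P" "d \<in> P" "w \<in> W" "w \<notin> P"
      "E w a" "E b w" "E d w"
    have "w \<noteq> q" using h PD asym by blast
    then have qw: "E q w" using h P_def total by blast
    have abd: "a \<in> W" "b \<in> W" "d \<in> W" "E a q" "E b q" "E d q" using h PD by auto
    have c1: "c a \<noteq> c b" "c b \<noteq> c d" "c a \<noteq> c d" using R[of a b d] h abd by auto
    have c2: "c w \<noteq> c a" "c w \<noteq> c b" using R[of w a b] h abd by auto
    have c3: "c q \<noteq> c w" "c q \<noteq> c a" using R[of q w a] h abd qw W by auto
    \<comment> \<open>Of the three colours on \<open>a b d\<close>, the triangles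
      \<open>w a b\<close> and \<open>q w a\<close> leave \<open>w\<close> only that of
      \<open>d\<close> and \<open>q\<close> only that of \<open>b\<close>.\<close>
    have cw: "c w = c d" "c b = c p"
      using colour_cases[OF c1(1,2,3), of "c w"] colour_cases[OF c1(1,2,3), of "c q"] c2 c3 pq by auto
    have pw: "E p w"
      using total[of p w] asym R[of p q w] W h qw pq cw c3 by (metis abd(4))
    have "c w = c r \<or> c w = c s" using colour_cases[OF col(1,2,3), of "c w"] c3 pq by auto
    then show False
    proof
      assume wr: "c w = c r"
      then have as: "c a = c s"
        using colour_cases[OF col(1,2,3), of "c a"] c1 cw by auto
      have rw: "E r w" using total[of r w] R[of r q w] W h qw rs wr by (metis P(1) insert_subset)
      have sw: "E s w"
      proof (rule ccontr)
        assume "\<not> E s w"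
        then have "E w s" using total[of s w] wr col by metis
        then show False using two_mixing_vertices[of p r s q w x] rs pq qw rw pw rsx by blast
      qed
      have "s \<noteq> a" using sw h asym by blast
      then have sa: "E s a" using total[of s a] R[of a s w] sw h abd W as by blast
      have "r \<noteq> a" using as col by auto
      then have ra: "E r a" using total[of r a] R[of a r s] sa rs abd W as by blast
      have "p \<noteq> a" using as col by auto
      then consider "E a p" | "E p a" using total by blast
      then show False
      proof cases
        case 1
        \<comment> \<open>\<open>a\<close> takes over the role of \<open>s\<close>: it has the same
          colour and, unlike \<open>s\<close>, is dominated by \<open>w\<close>.\<close>
        have cy: "cyc E p r a" using rs ra 1 by auto
        have "x \<noteq> a" using xW abd by auto
        have "\<not> E x a" using no_U5'[of r q a p x] cy rs pq abd rsx by blast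
        then have "E a x" using total[of a x] \<open>x \<noteq> a\<close> by blast
        then show False
          using two_mixing_vertices[of p r a q w x] cy rs pq qw rw pw rsx h abd by blast
      next
        case 2
        have "p \<noteq> b" using 2 h asym by blast
        then have pb: "E p b" using total[of p b] R[of b p a] 2 h abd W cw by metis
        have "\<not> E x b"
        proof
          assume xb: "E x b"
          have ne: "x \<noteq> a" "x \<noteq> d" using xW abd by auto
          have "\<not> (E x a \<and> E x d)"
            using no_triangle_to_arc_to_triangle[OF W(1), of a b d q x] W pq h abd xb by blast
          moreover have "\<not> (E x a \<and> E d x)" using no_U5'[of d q a b x] h abd pq xb by blast
          moreover have "\<not> (E a x \<and> E x d)" using no_U5'[of a q b d x] h abd pq xb by blast
          ultimately have "E a x" "E d x" using total ne by blast+
          then show False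
            using two_mixing_vertices[of b d a q w x] h abd pq qw xb by blast
        qed
        then show False using consec[of b] pb abd cw by blast
      qed
    next
      assume ws: "c w = c s"
      then have ar: "c a = c r"
        using colour_cases[OF col(1,2,3), of "c a"] c1 cw by auto
      have "p \<noteq> a" using ar col by auto
      have "b = p \<or> E b p" using consec[of b] total[of b p] abd cw by blast
      then have ap: "E a p"
      proof
        assume bp: "E b p"
        have "\<not> E p a" using R[of p a b] bp h abd W cw by metis
        then show ?thesis using total[of a p] \<open>p \<noteq> a\<close> by blast
      qed (use h in auto)
      have "r \<noteq> a" using ap rs asym by blast
      then have ar': "E a r" using total[of a r] R[of r a p] ap rs abd W ar by metis
      have "w \<noteq> r" using ws col by auto
      have "\<not> E r w" using R[of a r w] ar' h abd W ar by metis
      then have wr: "E w r" using total[of r w] \<open>w \<noteq> r\<close> by blast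
      have "s \<noteq> w" using qw rs asym by blast
      then have sw: "E s w" using total[of s w] R[of w s q] rs qw h W ws by metis
      show False using R[of w r s] wr rs sw h W ws by metis
    qed
  qed
qed

end

context U5_free
begin

text \<open>Induction on the number of vertices of this colour between \<open>p\<close> and
  \<open>q\<close>. Such a vertex \<open>m\<close> yields a closer pair, \<open>m q\<close> or
  \<open>p m\<close> depending on its arc with \<open>x\<close>. If there is none, a vertex
  splitting the set \<open>K\<close> of everything between \<open>p\<close> and \<open>q\<close>
  produces \<open>monochromatic_config\<close> or its reverse.\<close>

lemma no_monochromatic_triangle:
  assumes W: "prime_on E W" "3 \<le> card W" "rainbow E W c" and x: "x \<notin> W"
    and "p \<in> W" "q \<in> W" "E x p" "E p q" "E q x" "c p = c q"
  shows False
  using assms(5-10)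
proof (induction "card {m \<in> W. c m = c p \<and> E p m \<and> E m q}" arbitrary: p q rule: less_induct)
  case (less p q)
  note R = rainbowD[OF W(3)]
  have fin: "finite W" using W unfolding prime_on_def by blast
  have trans: "E u w" if "E u v" "E v w" "c u = c w" "u \<in> W" "v \<in> W" "w \<in> W" for u v w
    using R[of u v w] that total[of u w] asym by metis
  show False
  proof (cases "\<exists>m\<in>W. c m = c p \<and> E p m \<and> E m q")
    case True
    then obtain m where m: "m \<in> W" "c m = c p" "E p m" "E m q" by blast
    have "x \<noteq> m" using m x by blast
    have 1: "{m' \<in> W. c m' = c m \<and> E m m' \<and> E m' q} \<subset> {m \<in> W. c m = c p \<and> E p m \<and> E m q}"
      (is "?L \<subset> ?R")
    proof (rule psubsetI)
      show "?L \<subseteq> ?R" using m less.prems trans[of p m] by auto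
      have "m \<in> ?R" "m \<notin> ?L" using m by auto
      then show "?L \<noteq> ?R" by metis
    qed
    have 2: "{m' \<in> W. c m' = c p \<and> E p m' \<and> E m' m} \<subset> {m \<in> W. c m = c p \<and> E p m \<and> E m q}"
      (is "?L \<subset> ?R")
    proof (rule psubsetI)
      show "?L \<subseteq> ?R" using m less.prems trans[of _ m q] by auto
      have "m \<in> ?R" "m \<notin> ?L" using m by auto
      then show "?L \<noteq> ?R" by metis
    qed
    show False
    proof (cases "E x m")
      case True
      show False
        by (rule less.hyps[of m q]) (use psubset_card_mono[OF _ 1] fin m True less.prems in auto)
    next
      case False
      then have "E m x" using total \<open>x \<noteq> m\<close> by blast
      show False
        by (rule less.hyps[of p m]) (use psubset_card_mono[OF _ 2] fin m \<open>E m x\<close> less.prems in auto)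
    qed
  next
    case False
    define K where "K = {p, q} \<union> {m \<in> W. E p m \<and> E m q}"
    have "q \<in> W - {p}" using less.prems by auto
    \<comment> \<open>Strong connectivity supplies an in-neighbour \<open>z\<close> of
      \<open>p\<close>; it witnesses that \<open>K\<close> is not all of \<open>W\<close>.\<close>
    then obtain z z' where "z \<in> W - {p}" "z' \<in> W" "z' \<notin> W - {p}" "E z z'"
      using strong_onD[OF prime_strong[OF W(1,2)], of "W - {p}" q p] less.prems by blast
    then have z: "z \<in> W" "E z p" by auto
    have "z \<notin> K" using z less.prems asym[of z p] by (auto simp: K_def)
    have K: "K \<subseteq> W" "p \<in> K" "q \<in> K" "p \<noteq> q" using less.prems by (auto simp: K_def)
    obtain v s t where v: "v \<in> W" "v \<notin> K" "s \<in> K" "t \<in> K" "E v s" "E t v"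
      by (rule prime_onD[OF W(1) K z(1) \<open>z \<notin> K\<close>])
    have ne: "v \<noteq> p" "v \<noteq> q" using v K_def by auto
    have a: "\<not> (E p v \<and> E v q)" using v K_def by auto
    have b: "\<not> (E v p \<and> E q v)" using R[of p q v] less.prems v by auto
    show False
    proof (cases "E v p")
      case True
      then have vq: "E v q" using b ne total[of v q] by auto
      have "t \<noteq> p" "t \<noteq> q" using v True vq asym by auto
      then have "t \<in> W" "E p t" "E t q" using v(4) K_def by auto
      then show False
        using monochromatic_config[OF W(1,3), of p q t v x] less.prems v True vq x False by blast
    next
      case F: False
      then have pv: "E p v" using ne total[of p v] by auto
      then have qv: "E q v" using a ne total[of q v] by auto
      have "s \<noteq> p" "s \<noteq> q" using v pv qv asym by auto
      then have s: "s \<in> W" "E p s" "E s q" using v(3) K_def by auto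
      have consec: "c m = c q \<Longrightarrow> E m q \<Longrightarrow> E p m \<Longrightarrow> False" if "m \<in> W" for m
        using that False less.prems(6) by auto
      show False
        by (rule U5_free.monochromatic_config[OF conv, of W c q p s v x])
          (use W less.prems v pv qv x s consec in \<open>auto simp: prime_on_conv[of E] rainbow_conv[of E]\<close>)
    qed
  qed
qed

end

section \<open>All cyclic triangles through a new vertex use the same two colours\<close>

locale U5_T5_free = U5_free +
  assumes no_T5: "\<lbrakk>E a b; E a c; E b c; E b d; E c d; E c e; E d e; E d a; E e a; E e b\<rbrakk> \<Longrightarrow> False"
begin

lemma conv_T5: "U5_T5_free (\<lambda>x y. E y x)"
proof -
  interpret conv: U5_free "\<lambda>x y. E y x" by (rule conv)
  show ?thesis
    by unfold_locales (use no_T5 in blast)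
qed

text \<open>In the next three lemmas \<open>a\<close>, \<open>b\<close> and \<open>d, e, p, q\<close> lie before, after and between \<open>x\<close> and \<open>y\<close>, but
  the arc between \<open>x\<close> and \<open>y\<close> points backwards.\<close>

lemma flipped_arc_back:
  assumes "E y x" "E a x" "E a y" "E x b" "E y b" "E x d" "E d y" "E b a"
  shows "E a d \<and> E d b"
proof -
  have ne: "a \<noteq> d" "d \<noteq> b" using assms asym by blast+
  have "\<not> (E d a \<and> E d b)" using no_U5[of d b a y x] assms by blast
  moreover have "\<not> (E d a \<and> E b d)" using no_T5[of y x b d a] assms by blast
  moreover have "\<not> (E a d \<and> E b d)" using no_U5'[of a d x b y] assms by blast
  ultimately show ?thesis using total ne by blast
qed

lemma flipped_arc_source:
  assumes "E y x" "E a x" "E a y" "E x p" "E p y" "E x e" "E e y" "E p a" "E a e"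
  shows "\<not> E e p"
  using no_U5[of a y x e p] assms by blast

lemma flipped_arc_sink:
  assumes "E y x" "E x b" "E y b" "E x q" "E q y" "E x e" "E e y" "E b q" "E e b"
  shows "\<not> E q e"
  using no_U5'[of x b e y q] assms by blast

text \<open>\<open>W\<close> is cut into \<open>A\<close> before, \<open>D\<close> between and
  \<open>B\<close> after \<open>x\<close> and \<open>y\<close>, and strong connectivity demands a
  way back from \<open>B\<close>. Two colours in \<open>D\<close> forbid arcs from \<open>B\<close>
  to \<open>A\<close>, while the part \<open>Q\<close> of \<open>D\<close> entered from
  \<open>B\<close> is monochromatic. An arc leaving the set \<open>S\<close> built from
  \<open>Q\<close> then clashes with a vertex \<open>f\<close> of \<open>D\<close> in another
  colour.\<close>

lemma no_two_coloured_centre: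
  assumes W: "prime_on E W" "3 \<le> card W" "rainbow E W c" and x: "x \<notin> W"
    and y: "y \<in> W" "E y x" and p: "p \<in> W" "E x p" "E p y" and p': "p' \<in> W" "E x p'" "E p' y"
    and col: "c p \<noteq> c y" "c y \<noteq> c p'" "c p \<noteq> c p'"
    and last: "\<And>r. r \<in> W \<Longrightarrow> c r = c y \<Longrightarrow> E y r \<Longrightarrow> E x r"
  shows False
proof -
  note R = rainbowD[OF W(3)]
  note mono = no_monochromatic_triangle[OF W x]
  note strong = prime_strong[OF W(1,2)]
  have xW: "x \<noteq> m" if "m \<in> W" for m using x that by auto
  define A where "A = {a \<in> W. E a y \<and> E a x}"
  define D where "D = {d \<in> W. E d y \<and> E x d}"
  define B where "B = {b \<in> W. E y b}"
  define Q where "Q = {d \<in> D. \<exists>b\<in>B. E b d}"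
  define A' where "A' = {a \<in> A. \<exists>d\<in>Q. E d a}"
  have split: "z = y \<or> z \<in> A \<or> z \<in> D \<or> z \<in> B" if "z \<in> W" for z
    using that total[of z y] total[of z x] xW[OF that] unfolding A_def D_def B_def by auto
  have disj: "y \<notin> A" "y \<notin> D" "y \<notin> B" "A \<inter> D = {}" "A \<inter> B = {}" "D \<inter> B = {}"
    using asym unfolding A_def D_def B_def by auto
  have pD: "p \<in> D" "p' \<in> D" using p p' D_def by auto
  have AE: "a \<in> W" "E a y" "E a x" if "a \<in> A" for a using that A_def by auto
  have DE: "d \<in> W" "E d y" "E x d" if "d \<in> D" for d using that D_def by auto
  have BW: "b \<in> W" "E y b" if "b \<in> B" for b using that B_def by auto
  \<comment> \<open>The colour of \<open>b\<close> decides: that of \<open>y\<close> is excluded by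
    \<open>last\<close>, and that of \<open>p\<close> or \<open>p'\<close> would give a
    monochromatic triangle with \<open>x\<close>.\<close>
  have BE: "E x b" if "b \<in> B" for b
  proof (rule ccontr)
    assume "\<not> E x b"
    then have bx: "E b x" using total[of x b] xW[of b] BW that by blast
    have yb: "b \<in> W" "E y b" using BW that by auto
    have no: False if "d \<in> D" "c b = c d" "c d \<noteq> c y" for d
    proof -
      have "b \<noteq> d" using yb DE(2)[OF that(1)] asym by blast
      moreover have "\<not> E b d" using R[of d y b] DE[OF that(1)] yb y that by auto
      ultimately have "E d b" using total by blast
      then show False using mono[of d b] DE[OF that(1)] bx yb that by auto
    qed
    show False
      using no[OF pD(1)] no[OF pD(2)] colour_cases[OF col(1,2,3), of "c b"] col last yb bx asym by metis
  qed
  have Dy: "c d \<noteq> c y" if "d \<in> D" for d using mono[of d y] DE[OF that] y by auto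
  \<comment> \<open>Otherwise every \<open>d\<close> in \<open>D\<close> lies on a cyclic triangle
    \<open>d b a\<close>, so \<open>D\<close> has a single colour, although \<open>p\<close> and
    \<open>p'\<close> differ.\<close>
  have BA: "\<not> E b a" if "b \<in> B" "a \<in> A" for a b
  proof
    assume ba: "E b a"
    have cd: "c d \<noteq> c b \<and> c b \<noteq> c a \<and> c d \<noteq> c a" if "d \<in> D" for d
      using flipped_arc_back[OF y(2), of a b d] R[of d b a] ba DE[OF that] AE[OF \<open>a \<in> A\<close>]
        BW[OF \<open>b \<in> B\<close>] BE[OF \<open>b \<in> B\<close>] by blast
    show False using cd[OF pD(1)] cd[OF pD(2)] col(3) colour_cases by metis
  qed
  have AB: "E a b" if "b \<in> B" "a \<in> A" for a b
    using BA[OF that] total[of a b] that disj by blast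
  have ybd: "c y \<noteq> c b \<and> c b \<noteq> c d \<and> c y \<noteq> c d" if "b \<in> B" "d \<in> D" "E b d" for b d
    using R[of y b d] that BW[OF that(1)] DE[OF that(2)] y by blast
  have sink: "E e d" if "b \<in> B" "d \<in> D" "E b d" "e \<in> D" "E e b" for b d e
  proof -
    have "\<not> E d e" using flipped_arc_sink[OF y(2), of b d e] that BW BE DE by blast
    moreover have "e \<noteq> d" using that asym by blast
    ultimately show ?thesis using total by blast
  qed
  have DQ: "E e d" if "e \<in> D" "e \<notin> Q" "d \<in> Q" for d e
  proof -
    obtain b where b: "b \<in> B" "E b d" "d \<in> D" using \<open>d \<in> Q\<close> Q_def by auto
    have "\<not> E b e" using that b Q_def by auto
    then have "E e b" using total[of e b] that b disj by blast
    then show ?thesis using sink b that by blast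
  qed
  have Qcol1: "E e d" if "d \<in> Q" "e \<in> D" "c e \<noteq> c d" for d e
  proof -
    obtain b where b: "b \<in> B" "E b d" "d \<in> D" using \<open>d \<in> Q\<close> Q_def by auto
    have "c b = c e" using ybd[of b d] b Dy that colour_cases by metis
    then have "\<not> E b e" using ybd[of b e] b that by blast
    then have "E e b" using total[of e b] that b disj by blast
    then show ?thesis using sink b that by blast
  qed
  have Qcol: "c e = c d" if "d \<in> Q" "e \<in> Q" for d e
    using Qcol1[of d e] Qcol1[of e d] that asym unfolding Q_def by auto
  have "Q \<noteq> {}"
  proof
    assume "Q = {}"
    obtain s z where sz: "s \<in> insert y B" "z \<in> W" "z \<notin> insert y B" "E s z"
      by (rule strong_onD[OF strong, of "insert y B" y p]) (use y p BW disj pD in auto)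
    have "z \<in> A \<or> z \<in> D" "s \<noteq> y" using split sz unfolding B_def by auto
    then show False using BA sz \<open>Q = {}\<close> unfolding Q_def by auto
  qed
  then obtain q where q: "q \<in> Q" by blast
  obtain f where f: "f \<in> D" "c f \<noteq> c q" using pD col(3) by metis
  then have fQ: "f \<notin> Q" using Qcol q by blast
  \<comment> \<open>\<open>S\<close> misses \<open>f\<close>, so an arc leaves it; the orders found
    so far force that arc to run from \<open>A'\<close> to the rest of \<open>A\<close>.\<close>
  define S where "S = Q \<union> B \<union> {y} \<union> A'"
  have QD: "Q \<subseteq> D" and AA: "A' \<subseteq> A" unfolding Q_def A'_def by auto
  have "S \<subseteq> W" using QD AA AE BW DE y unfolding S_def by auto
  moreover have "f \<notin> S" using f fQ AA disj unfolding S_def by auto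
  moreover have "y \<in> S" unfolding S_def by auto
  ultimately obtain s z where sz: "s \<in> S" "z \<in> W" "z \<notin> S" "E s z"
    using strong_onD[OF strong] f DE by metis
  have source: "E d e" if "d \<in> D" "a \<in> A" "E d a" "e \<in> D" "E a e" for d a e
  proof -
    have "\<not> E e d" using flipped_arc_source[OF y(2), of a d e] that AE DE by blast
    moreover have "e \<noteq> d" using that asym by blast
    ultimately show ?thesis using total by blast
  qed
  have zz: "(z \<in> A \<and> z \<notin> A') \<or> (z \<in> D \<and> z \<notin> Q)" using split sz S_def by auto
  then have "s \<noteq> y" using sz disj unfolding A_def D_def by (auto dest: asym)
  moreover have "s \<notin> B" using zz BA sz unfolding Q_def by auto
  moreover have "s \<notin> Q" using zz DQ sz asym unfolding A'_def by auto
  ultimately have s: "s \<in> A'" using sz S_def by auto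
  then obtain d where d: "d \<in> Q" "E d s" "s \<in> A" unfolding A'_def by auto
  then obtain b where b: "b \<in> B" "E b d" "d \<in> D" unfolding Q_def by auto
  have DQ': "E e s" if "e \<in> D" "e \<notin> Q" for e
  proof (rule ccontr)
    assume "\<not> E e s"
    then have "E s e" using total[of e s] that d disj by blast
    then show False using source[of d s e] DQ[of e d] b d that asym by blast
  qed
  have z: "z \<in> A" "z \<notin> A'" using zz DQ' sz asym by blast+
  then have "E z d" using total[of z d] d disj QD unfolding A'_def by blast
  then have 1: "c s \<noteq> c z \<and> c z \<noteq> c d \<and> c s \<noteq> c d"
    using R[of s z d] d sz DE AE b by auto
  have 2: "c d \<noteq> c s \<and> c s \<noteq> c b \<and> c d \<noteq> c b"
    using R[of d s b] d b AB[of b s] DE AE BW by auto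
  have "c d = c q" by (rule Qcol[OF q d(1)])
  then have "c b = c f" using ybd[OF b(1,3,2)] f Dy[OF f(1)] colour_cases by metis
  then have zf: "c z = c f" using 1 2 colour_cases[of "c s" "c b" "c d" "c z"] by metis
  \<comment> \<open>Both directions fail, as \<open>z\<close> and \<open>f\<close> share a colour:
    \<open>E f z\<close> gives a monochromatic triangle with \<open>x\<close>, and
    \<open>E z f\<close> the cyclic triangle \<open>f s z\<close>.\<close>
  have "z \<noteq> f" using z f disj by blast
  moreover have "\<not> E f z" 
    using mono[OF DE(1)[OF f(1)] AE(1)[OF z(1)] DE(3)[OF f(1)] _ AE(3)[OF z(1)]] zf by auto
  ultimately have "E z f" using total by blast
  then show False using R[of f s z] DQ'[OF f(1) fQ] sz z AE DE f d zf by auto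
qed

text \<open>The in-neighbours of \<open>x\<close> in the colour of \<open>q\<close> are linearly
  ordered, and the last of them inherits the arcs from \<open>p\<close> and from \<open>p'\<close>.
  It serves as the centre \<open>y\<close> in \<open>no_two_coloured_centre\<close>.\<close>

lemma same_colour_pair:
  assumes W: "prime_on E W" "3 \<le> card W" "rainbow E W c" and x: "x \<notin> W"
    and p: "p \<in> W" "q \<in> W" "E x p" "E p q" "E q x"
    and p': "p' \<in> W" "q' \<in> W" "E x p'" "E p' q'" "E q' x"
    and "c q = c q'"
  shows "c p = c p'"
proof (rule ccontr)
  assume ne: "c p \<noteq> c p'"
  note R = rainbowD[OF W(3)]
  note mono = no_monochromatic_triangle[OF W x]
  define S where "S = {w \<in> W. c w = c q \<and> E w x}"
  have "finite S" using W unfolding prime_on_def S_def by auto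
  moreover have "q \<in> S" using p S_def by auto
  moreover have "\<not> cyc E a b d" if "a \<in> S" "b \<in> S" "d \<in> S" for a b d
    using R[of a b d] that unfolding S_def by auto
  ultimately obtain y where y: "y \<in> S" "\<And>t. t \<in> S \<Longrightarrow> t \<noteq> y \<Longrightarrow> E t y"
    using acyclic_sink[of S] by blast
  have yW: "y \<in> W" "c y = c q" "E y x" using y S_def by auto
  have cp: "c p \<noteq> c q" "c p' \<noteq> c q" using mono[of p q] mono[of p' q'] p p' assms by auto
  have arc: "E r y" if r: "r \<in> W" "E r t" "t \<in> W" "c t = c q" "E t x" "c r \<noteq> c q" for r t
  proof (cases "t = y")
    case False
    then have "E t y" using y S_def that by auto
    then show ?thesis using R[of r t y] r yW total[of r y] by metis
  qed (use r in auto)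
  have "E x r" if "r \<in> W" "c r = c y" "E y r" for r
    using y(2)[of r] total[of x r] asym[of y r] that x yW unfolding S_def by auto
  then show False
    using no_two_coloured_centre[OF W x yW(1,3), of p p'] arc[of p q] arc[of p' q'] p p' cp yW ne
      assms(15) by metis
qed

lemma same_colour_pair':
  assumes W: "prime_on E W" "3 \<le> card W" "rainbow E W c" and x: "x \<notin> W"
    and p: "p \<in> W" "q \<in> W" "E x p" "E p q" "E q x"
    and p': "p' \<in> W" "q' \<in> W" "E x p'" "E p' q'" "E q' x"
    and "c p = c p'"
  shows "c q = c q'"
  by (rule U5_T5_free.same_colour_pair[OF conv_T5, of W c x q p q' p'])
    (use assms in \<open>auto simp: prime_on_conv[of E] rainbow_conv[of E]\<close>)

text \<open>Otherwise \<open>p\<close>, \<open>q\<close>, \<open>p'\<close>, \<open>q'\<close> are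
  ordered this way, where \<open>E p q'\<close> comes from avoiding \<open>U\<^sub>5\<close>. Then
  \<open>p q'\<close> is a further pair starting in \<open>p\<close>, and
  \<open>same_colour_pair'\<close> equates the colours of \<open>q\<close> and
  \<open>q'\<close>.\<close>

lemma opposite_colour_pair:
  assumes W: "prime_on E W" "3 \<le> card W" "rainbow E W c" and x: "x \<notin> W"
    and p: "p \<in> W" "q \<in> W" "E x p" "E p q" "E q x"
    and p': "p' \<in> W" "q' \<in> W" "E x p'" "E p' q'" "E q' x"
    and eq: "c q = c p'"
  shows "c p = c q'"
proof (rule ccontr)
  assume ne: "c p \<noteq> c q'"
  note R = rainbowD[OF W(3)]
  note mono = no_monochromatic_triangle[OF W x]
  have cp: "c p \<noteq> c q" "c p' \<noteq> c q'" using mono[of p q] mono[of p' q'] p p' by auto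
  have "q \<noteq> p'" using p p' asym by blast
  then have qp': "E q p'" using mono[of p' q] total[of q p'] p p' eq by auto
  have pp': "E p p'" using R[of p q p'] total[of p p'] cp p p' qp' eq by metis
  have qq': "E q q'" using R[of q p' q'] total[of q q'] cp p p' qp' eq by metis
  have "\<not> E q' p" using no_U5[of q p' q' x p] p p' pp' qq' qp' by blast
  moreover have "p \<noteq> q'" using ne by auto
  ultimately have "E p q'" using total by blast
  then show False using same_colour_pair'[OF W x p, of p q'] p p' cp eq by auto
qed

text \<open>Two pairs out of three colours always meet, so by the preceding lemmas all cyclic
  triangles through \<open>x\<close> use one pair; \<open>x\<close> receives the remaining
  colour.\<close>

lemma one_vertex_colouring:
  assumes W: "prime_on E W" "3 \<le> card W" "rainbow E W c" and x: "x \<notin> W"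
  obtains k where "rainbow E (insert x W) (c(x := k))"
proof -
  note mono = no_monochromatic_triangle[OF W x]
  have suff: "rainbow E (insert x W) (c(x := k))"
    if k: "\<And>p q. p \<in> W \<Longrightarrow> q \<in> W \<Longrightarrow> E x p \<Longrightarrow> E p q \<Longrightarrow> E q x \<Longrightarrow> k \<noteq> c p \<and> k \<noteq> c q" for k
    unfolding rainbow_def
  proof (intro ballI impI)
    fix a b d assume h: "a \<in> insert x W" "b \<in> insert x W" "d \<in> insert x W" "cyc E a b d"
    then have "a \<noteq> b" "b \<noteq> d" "a \<noteq> d" by auto
    then consider "a = x" "b \<in> W" "d \<in> W" | "b = x" "a \<in> W" "d \<in> W" | "d = x" "a \<in> W" "b \<in> W"
      | "a \<in> W" "b \<in> W" "d \<in> W" using h by auto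
    then show "(c(x := k)) a \<noteq> (c(x := k)) b"
    proof cases
      case 1 then show ?thesis using k[of b d] h x by auto
    next
      case 2 then show ?thesis using k[of d a] h x by auto
    next
      case 3 then show ?thesis using mono[of a b] h x by auto
    next
      case 4 then show ?thesis using rainbowD[OF W(3), of a b d] h x by auto
    qed
  qed
  show thesis
  proof (cases "\<exists>p\<in>W. \<exists>q\<in>W. E x p \<and> E p q \<and> E q x")
    case True
    then obtain p q where p: "p \<in> W" "q \<in> W" "E x p" "E p q" "E q x" by blast
    then have "c p \<noteq> c q" using mono by blast
    then obtain k where k: "k \<noteq> c p" "k \<noteq> c q" by (metis colour.distinct)
    have "k \<noteq> c p' \<and> k \<noteq> c q'" if p': "p' \<in> W" "q' \<in> W" "E x p'" "E p' q'" "E q' x" for p' q'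
    proof -
      have "c p' \<noteq> c q'" using mono p' by blast
      moreover have "c q = c q' \<Longrightarrow> c p = c p'" by (rule same_colour_pair[OF W x p p'])
      moreover have "c p = c p' \<Longrightarrow> c q = c q'" by (rule same_colour_pair'[OF W x p p'])
      moreover have "c q = c p' \<Longrightarrow> c p = c q'" by (rule opposite_colour_pair[OF W x p p'])
      moreover have "c q' = c p \<Longrightarrow> c p' = c q" by (rule opposite_colour_pair[OF W x p' p])
      ultimately show ?thesis
        using k \<open>c p \<noteq> c q\<close> colour_cases[of "c p" "c q" k] by metis
    qed
    then show thesis using suff[of k] that by blast
  next
    case False
    then show thesis using suff[of Red] that by blast
  qed
qed

end

section \<open>Extending a prime subtournament by two vertices\<close>

definition twin_on :: "('a \<Rightarrow> 'a \<Rightarrow> bool) \<Rightarrow> 'a set \<Rightarrow> 'a \<Rightarrow> 'a \<Rightarrow> bool" where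
  "twin_on E W x u \<longleftrightarrow> (\<forall>p\<in>W - {u}. (E x p \<longleftrightarrow> E u p) \<and> (E p x \<longleftrightarrow> E p u))"

lemma twin_onD:
  assumes "twin_on E W x u" "p \<in> W" "p \<noteq> u"
  shows "E x p \<longleftrightarrow> E u p" "E p x \<longleftrightarrow> E p u"
  using assms unfolding twin_on_def by auto

lemma twin_on_conv: "twin_on (\<lambda>x y. E y x) W x u \<longleftrightarrow> twin_on E W x u"
  unfolding twin_on_def by auto

context tournament_rel
begin

lemma conv_tournament: "tournament_rel (\<lambda>x y. E y x)"
  by unfold_locales (use asym total in blast)+

lemma third_vertex:
  assumes "3 \<le> card W"
  obtains z where "z \<in> W" "z \<noteq> u" "z \<noteq> v"
proof -
  have "\<not> W \<subseteq> {u, v}"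
    using assms card_mono[of "{u, v}" W] card_insert_le_m1[of 2 "{v}" u] by auto
  then show thesis using that by blast
qed

lemma twin_onI:
  assumes "x \<notin> W" "u \<in> W" "\<And>p. p \<in> W \<Longrightarrow> p \<noteq> u \<Longrightarrow> E p x \<longleftrightarrow> E p u"
  shows "twin_on E W x u"
  unfolding twin_on_def using assms asym total by (metis DiffD1 DiffD2 singletonI)

lemma prime_no_twins:
  assumes "prime_on E W" "3 \<le> card W" "u \<in> W" "v \<in> W" "u \<noteq> v"
  obtains p where "p \<in> W" "p \<noteq> u" "p \<noteq> v" "E p u \<noteq> E p v"
proof -
  obtain z where z: "z \<in> W" "z \<noteq> u" "z \<noteq> v" using third_vertex[OF assms(2)] .
  obtain p x y where "p \<in> W" "p \<notin> {u, v}" "x \<in> {u, v}" "y \<in> {u, v}" "E p x" "E y p"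
    by (rule prime_onD[OF assms(1), of "{u, v}" u v z]) (use assms z in auto)
  then show thesis using that[of p] asym by auto
qed

lemma prime_in_out:
  assumes "prime_on E W" "3 \<le> card W" "u \<in> W"
  obtains p q where "p \<in> W" "E p u" "q \<in> W" "E u q"
proof -
  note strong = prime_strong[OF assms(1,2)]
  obtain z where z: "z \<in> W" "z \<noteq> u" using third_vertex[OF assms(2)] by metis
  obtain a b where "a \<in> {u}" "b \<in> W" "b \<notin> {u}" "E a b"
    by (rule strong_onD[OF strong, of "{u}" u z]) (use assms z in auto)
  moreover obtain a' b' where "a' \<in> W - {u}" "b' \<in> W" "b' \<notin> W - {u}" "E a' b'"
    by (rule strong_onD[OF strong, of "W - {u}" z u]) (use assms z in auto)
  ultimately show thesis using that by auto
qed

lemma prime_homogeneous_superset: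
  assumes "prime_on E W" "W \<subseteq> V" "a \<in> I" "b \<in> I" "a \<in> W" "b \<in> W" "a \<noteq> b"
    and hom: "\<And>v x y. v \<in> V \<Longrightarrow> v \<notin> I \<Longrightarrow> x \<in> I \<Longrightarrow> y \<in> I \<Longrightarrow> E v x \<Longrightarrow> E v y"
  shows "W \<subseteq> I"
proof (rule ccontr)
  assume "\<not> W \<subseteq> I"
  then obtain z where z: "z \<in> W" "z \<notin> I \<inter> W" by auto
  obtain v x y where "v \<in> W" "v \<notin> I \<inter> W" "x \<in> I \<inter> W" "y \<in> I \<inter> W" "E v x" "E y v"
    by (rule prime_onD[OF assms(1), of "I \<inter> W" a b z]) (use assms z in auto)
  then show False using hom[of v x y] asym assms(2) by blast
qed

text \<open>A nontrivial homogeneous set either has two vertices in \<open>W\<close>, hence contains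
  \<open>W\<close> and makes \<open>x\<close> uniform, or consists of \<open>x\<close> and one
  vertex of \<open>W\<close>, which are then twins.\<close>

lemma prime_insert:
  assumes W: "prime_on E W" and x: "x \<notin> W" and un: "\<not> uniform_to E x W"
    and tw: "\<And>u. u \<in> W \<Longrightarrow> \<not> twin_on E W x u"
  shows "prime_on E (insert x W)"
proof (rule prime_onI)
  show "finite (insert x W)" using W unfolding prime_on_def by auto
  fix I a b z
  assume I: "I \<subseteq> insert x W" "a \<in> I" "b \<in> I" "a \<noteq> b" "z \<in> insert x W" "z \<notin> I"
    and hom: "\<And>v s t. v \<in> insert x W \<Longrightarrow> v \<notin> I \<Longrightarrow> s \<in> I \<Longrightarrow> t \<in> I \<Longrightarrow> E v s \<Longrightarrow> E v t"
  show False
  proof (cases "a \<in> W \<and> b \<in> W")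
    case True
    have "W \<subseteq> I"
    proof (rule prime_homogeneous_superset[OF W subset_insertI I(2,3) _ _ I(4)])
      show "a \<in> W" "b \<in> W" using True by auto
    qed (erule (4) hom)
    then have "z = x" using I by auto
    then have "E x p" if "E x q" "p \<in> W" "q \<in> W" for p q
      using hom[of x q p] I that \<open>W \<subseteq> I\<close> by blast
    then show False using un x total unfolding uniform_to_def by metis
  next
    case False
    then obtain u where u: "u \<in> W" "u \<in> I" "x \<in> I" using I by auto
    have sub: "I \<inter> W = {u}"
    proof (rule ccontr)
      assume "I \<inter> W \<noteq> {u}"
      then obtain u' where u': "u' \<in> I" "u' \<in> W" "u' \<noteq> u" using u by auto
      have "W \<subseteq> I"
        by (rule prime_homogeneous_superset[OF W subset_insertI u'(1) u(2) u'(2) u(1) u'(3)]) (erule (4) hom)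
      then show False using I u by auto
    qed
    have "twin_on E W x u"
    proof (rule twin_onI[OF x u(1)])
      fix p assume "p \<in> W" "p \<noteq> u"
      then have "p \<notin> I" "p \<in> insert x W" using sub by auto
      then show "E p x \<longleftrightarrow> E p u" using hom u by blast
    qed
    then show False using tw u by blast
  qed
qed

text \<open>Adding \<open>x\<close> alone creates the homogeneous pair of \<open>x\<close> and
  \<open>u\<close>, and \<open>y\<close> is chosen to split it. The cases follow how a homogeneous
  set meets \<open>W\<close>: in two vertices, in one, or not at all.\<close>

lemma prime_insert_twin:
  assumes W: "prime_on E W" "3 \<le> card W" and xy: "x \<notin> W" "y \<notin> W" "x \<noteq> y"
    and u: "u \<in> W" "twin_on E W x u" and dist: "E y x \<noteq> E y u"
    and y: "uniform_to E y W \<or> (\<exists>u'\<in>W. u' \<noteq> u \<and> twin_on E W y u')"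
  shows "prime_on E (insert x (insert y W))"
proof (rule prime_onI)
  have fin: "finite W" using W unfolding prime_on_def by auto
  then show "finite (insert x (insert y W))" by auto
  fix I a b z
  assume I: "I \<subseteq> insert x (insert y W)" "a \<in> I" "b \<in> I" "a \<noteq> b" "z \<in> insert x (insert y W)" "z \<notin> I"
    and hom: "\<And>v s t. v \<in> insert x (insert y W) \<Longrightarrow> v \<notin> I \<Longrightarrow> s \<in> I \<Longrightarrow> t \<in> I \<Longrightarrow> E v s \<Longrightarrow> E v t"
  have hom': "E p s \<longleftrightarrow> E p t" if "p \<in> insert x (insert y W)" "p \<notin> I" "s \<in> I" "t \<in> I" for p s t
    using hom that by blast
  have neW: "p \<noteq> x" "p \<noteq> y" if "p \<in> W" for p using that xy by auto
  have tx: "E p x \<longleftrightarrow> E p u" "E x p \<longleftrightarrow> E u p" if "p \<in> W" "p \<noteq> u" for p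
    using twin_onD[OF u(2) that] by auto
  have not_un: "\<exists>p\<in>W. \<exists>q\<in>W. p \<noteq> v \<and> q \<noteq> v \<and> E p v \<and> \<not> E q v" if v: "v \<in> W" for v
    using prime_in_out[OF W v] asym irrefl by metis
  have yun: "(\<forall>p\<in>W. E p y) \<or> (\<forall>p\<in>W. \<not> E p y) \<or> (\<exists>u'\<in>W. u' \<noteq> u \<and> twin_on E W y u')"
    using y asym unfolding uniform_to_def by blast
  show False
  proof (cases "\<exists>s t. s \<in> I \<inter> W \<and> t \<in> I \<inter> W \<and> s \<noteq> t")
    case True
    then obtain s t where st: "s \<in> I" "t \<in> I" "s \<in> W" "t \<in> W" "s \<noteq> t" by auto
    have sub: "W \<subseteq> insert x (insert y W)" by auto
    have WI: "W \<subseteq> I"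
      by (rule prime_homogeneous_superset[OF W(1) sub st]) (erule (4) hom)
    have "x \<in> I"
    proof (rule ccontr)
      assume "x \<notin> I"
      then have "E x p \<longleftrightarrow> E x q" if "p \<in> W" "q \<in> W" for p q using hom'[of x p q] that WI by blast
      then show False using not_un[OF u(1)] tx neW asym total u(1) by metis
    qed
    moreover have "y \<in> I" using hom'[of y x u] dist \<open>x \<in> I\<close> WI u by blast
    ultimately show False using I WI by auto
  next
    case False
    then have uniq: "s = t" if "s \<in> I" "t \<in> I" "s \<in> W" "t \<in> W" for s t using that by blast
    have pI: "p \<notin> I" if "p \<in> W" "v \<in> I" "v \<in> W" "p \<noteq> v" for p v using uniq that by blast
    show False
    proof (cases "\<exists>v. v \<in> I \<and> v \<in> W")
      case True
      then obtain v where v: "v \<in> I" "v \<in> W" by blast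
      show False
      proof (cases "x \<in> I")
        case True
        have "v = u"
        proof (rule ccontr)
          assume "v \<noteq> u"
          then obtain p where p: "p \<in> W" "p \<noteq> v" "p \<noteq> u" "E p v \<noteq> E p u"
            using prime_no_twins[OF W v(2) u(1)] by metis
          then show False using hom'[of p x v] pI[OF p(1) v p(2)] tx[OF p(1,3)] True v by blast
        qed
        then have "y \<in> I" using hom'[of y x u] True v dist by blast
        then have ty: "E p y \<longleftrightarrow> E p u" if "p \<in> W" "p \<noteq> u" for p
          using hom'[of p y u] pI[OF that(1) v] v \<open>v = u\<close> that by blast
        show False using yun
        proof (elim disjE bexE conjE)
          fix u' assume u': "u' \<in> W" "u' \<noteq> u" "twin_on E W y u'"
          obtain p where "p \<in> W" "p \<noteq> u'" "p \<noteq> u" "E p u' \<noteq> E p u"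
            using prime_no_twins[OF W u'(1) u(1) u'(2)] by metis
          then show False using ty twin_onD[OF u'(3)] by blast
        qed (use not_un[OF u(1)] ty in blast)+
      next
        case False
        then have "y \<in> I" using I uniq by blast
        then have ty: "E p y \<longleftrightarrow> E p v" if "p \<in> W" "p \<noteq> v" for p
          using hom'[of p y v] pI[OF that(1) v] v that by blast
        show False using yun
        proof (elim disjE bexE conjE)
          fix u' assume u': "u' \<in> W" "u' \<noteq> u" "twin_on E W y u'"
          have "v = u'"
          proof (rule ccontr)
            assume "v \<noteq> u'"
            then obtain p where "p \<in> W" "p \<noteq> v" "p \<noteq> u'" "E p v \<noteq> E p u'"
              using prime_no_twins[OF W v(2) u'(1)] by metis
            then show False using ty twin_onD[OF u'(3)] by blast
          qed
          then have "E x y \<longleftrightarrow> E x u'" using hom'[of x y u'] False \<open>y \<in> I\<close> v by blast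
          moreover have "E x u' \<longleftrightarrow> E u u'" using tx u' by blast
          moreover have "E u y \<longleftrightarrow> E u u'" using twin_onD[OF u'(3) u(1)] u' by blast
          ultimately show False using dist asym total neW(2)[OF u(1)] xy(3) by metis
        qed (use not_un[OF v(2)] ty in blast)+
      qed
    next
      case False
      then have "x \<in> I" "y \<in> I" using I by blast+
      then have ty: "E p y \<longleftrightarrow> E p x" if "p \<in> W" for p using hom'[of p y x] False that by blast
      show False using yun
      proof (elim disjE bexE conjE)
        fix u' assume u': "u' \<in> W" "u' \<noteq> u" "twin_on E W y u'"
        obtain p where "p \<in> W" "p \<noteq> u'" "p \<noteq> u" "E p u' \<noteq> E p u"
          using prime_no_twins[OF W u'(1) u(1) u'(2)] by metis
        then show False using ty tx twin_onD[OF u'(3)] by blast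
      qed (use not_un[OF u(1)] ty tx in blast)+
    qed
  qed
qed

section \<open>Colouring two added vertices together\<close>

lemma triangle_third_vertex:
  assumes "cyc E a b d" "x \<in> {a, b, d}" "y \<in> {a, b, d}" "x \<noteq> y"
  obtains p where "p \<in> {a, b, d}" "cyc E x y p \<or> cyc E y x p"
  using assms that[of a] that[of b] that[of d] by auto

text \<open>A uniform vertex lies on no cyclic triangle with vertices of \<open>W\<close>. Hence
  \<open>c'\<close> is free at \<open>y\<close>, which is exploited when \<open>y\<close> is added
  along with a twin.\<close>

lemma uniform_rainbow:
  assumes "rainbow E W c" "uniform_to E y W" "y \<notin> W" "\<And>p. p \<in> W \<Longrightarrow> c' p = c p"
  shows "rainbow E (insert y W) c'"
  unfolding rainbow_def
proof (intro ballI impI)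
  fix a b d assume h: "a \<in> insert y W" "b \<in> insert y W" "d \<in> insert y W" "cyc E a b d"
  have "a \<noteq> b" "b \<noteq> d" "a \<noteq> d" using h by auto
  moreover have "\<not> (E p y \<and> E y q)" if "p \<in> W" "q \<in> W" for p q
    using assms(2) that asym unfolding uniform_to_def by blast
  ultimately have "a \<in> W" "b \<in> W" "d \<in> W" using h by blast+
  then show "c' a \<noteq> c' b" using rainbowD[OF assms(1), of a b d] h assms(4) by auto
qed

text \<open>Twins lie on no common cyclic triangle here, so replacing \<open>x\<close> by
  \<open>u\<close> sends cyclic triangles to cyclic triangles.\<close>

lemma twin_rainbow:
  assumes "rainbow E W c" "twin_on E W x u" "x \<notin> W" "u \<in> W"
    and "\<And>p. p \<in> W \<Longrightarrow> c' p = c p" "c' x = c u"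
  shows "rainbow E (insert x W) c'"
  unfolding rainbow_def
proof (intro ballI impI)
  fix a b d assume h: "a \<in> insert x W" "b \<in> insert x W" "d \<in> insert x W" "cyc E a b d"
  define f where "f v = (if v = x then u else v)" for v
  have fW: "f v \<in> W" if "v \<in> insert x W" for v using that assms f_def by auto
  have fc: "c' v = c (f v)" if "v \<in> insert x W" for v using that assms f_def by auto
  have ne: "a \<noteq> b" "b \<noteq> d" "a \<noteq> d" using h by auto
  have no: "\<not> (E p x \<and> E u p)" "\<not> (E x p \<and> E p u)" if "p \<in> W" "p \<noteq> u" for p
    using twin_onD[OF assms(2) that] asym by blast+
  have nx: "\<not> (x \<in> {a, b, d} \<and> u \<in> {a, b, d})"
  proof
    assume "x \<in> {a, b, d} \<and> u \<in> {a, b, d}"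
    moreover have "x \<noteq> u" using assms by auto
    ultimately obtain p where p: "p \<in> {a, b, d}" "cyc E x u p \<or> cyc E u x p"
      using triangle_third_vertex[OF h(4)] by blast
    then have "p \<noteq> x" "p \<noteq> u" "p \<in> W" using h by auto
    then show False using no p by blast
  qed
  have fE: "E (f p) (f q)" if "E p q" "p \<in> {a, b, d}" "q \<in> {a, b, d}" for p q
  proof -
    have "p \<in> insert x W" "q \<in> insert x W" using that h by auto
    then show ?thesis using twin_onD[OF assms(2)] that nx ne unfolding f_def
      by (metis insert_iff irrefl)
  qed
  show "c' a \<noteq> c' b"
    using rainbowD[OF assms(1), of "f a" "f b" "f d"] fE[of a b] fE[of b d] fE[of d a] fW fc h by auto
qed

lemma pair_rainbow:
  assumes "rainbow E (insert x W) c" "rainbow E (insert y W) c"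
    and xyp: "\<And>p. p \<in> W \<Longrightarrow> cyc E x y p \<or> cyc E y x p \<Longrightarrow> c x \<noteq> c y \<and> c y \<noteq> c p \<and> c x \<noteq> c p"
  shows "rainbow E (insert x (insert y W)) c"
  unfolding rainbow_def
proof (intro ballI impI)
  fix a b d assume h: "a \<in> insert x (insert y W)" "b \<in> insert x (insert y W)"
    "d \<in> insert x (insert y W)" "cyc E a b d"
  have ne: "a \<noteq> b" "b \<noteq> d" "a \<noteq> d" using h by auto
  show "c a \<noteq> c b"
  proof (cases "x \<in> {a, b, d} \<and> y \<in> {a, b, d}")
    case False
    then have "{a, b, d} \<subseteq> insert x W \<or> {a, b, d} \<subseteq> insert y W" using h by auto
    then show ?thesis using rainbowD[OF assms(1), of a b d] rainbowD[OF assms(2), of a b d] h by auto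
  next
    case True
    show ?thesis
    proof (cases "x = y")
      case True
      then show ?thesis using rainbowD[OF assms(1), of a b d] h by auto
    next
      case False
      then obtain p where p: "p \<in> {a, b, d}" "cyc E x y p \<or> cyc E y x p"
        using triangle_third_vertex[OF h(4)] True by blast
      then have "p \<noteq> x" "p \<noteq> y" by auto
      then have "p \<in> W" "{a, b, d} = {x, y, p}" using p h ne True False by auto
      then have "c x \<noteq> c y \<and> c y \<noteq> c p \<and> c x \<noteq> c p" "a \<in> {x, y, p}" "b \<in> {x, y, p}"
        using xyp[of p] p by auto
      then show ?thesis using ne by auto
    qed
  qed
qed

end

context U5_free
begin

text \<open>\<open>x\<close> takes the colour of \<open>u\<close>, and \<open>y\<close> that of a
  vertex \<open>w\<close> of \<open>W\<close> placed with respect to \<open>u\<close> and its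
  in-neighbours as \<open>y\<close> is with respect to \<open>x\<close> and them. Such a
  \<open>w\<close> is found as an in-neighbour of the first vertex of the in-neighbourhood
  \<open>N\<close>, which is linearly ordered.\<close>

lemma twin_uniform_rainbow_out:
  assumes W: "prime_on E W" "3 \<le> card W" "rainbow E W c" and xy: "x \<notin> W" "y \<notin> W"
    and u: "u \<in> W" "twin_on E W x u" and y: "\<And>p. p \<in> W \<Longrightarrow> E y p" "E x y"
  obtains c' where "rainbow E (insert x (insert y W)) c'"
proof -
  note R = rainbowD[OF W(3)]
  note strong = prime_strong[OF W(1,2)]
  have fin: "finite W" using W unfolding prime_on_def by blast
  have ne: "x \<noteq> u" using xy u by auto
  note tw = twin_onD[OF u(2)]
  obtain z where z: "z \<in> W" "z \<noteq> u" using third_vertex[OF W(2)] by metis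
  obtain a b d where t: "cyc E a b d" "a \<in> {u}" "b \<in> W" "b \<notin> {u}" "d \<in> W"
    by (rule crossing_triangle[OF strong, of "{u}" u z]) (use u z in auto)
  have "\<not> E u x"
    using no_U5[of y b d u x] t y u tw[of b] tw[of d] by auto
  then have xu: "E x u" using total ne by blast
  have notri: False if "a \<in> W" "b \<in> W" "d \<in> W" "cyc E a b d" "E u a" "E b u" "E d u" for a b d
  proof -
    have "a \<noteq> u" "b \<noteq> u" "d \<noteq> u" using that by auto
    then show False using no_U5[of y a b d x] that y tw[of a] tw[of b] tw[of d] by blast
  qed
  define N where "N = {m \<in> W. E m u}"
  have N: "N \<subseteq> W" "u \<notin> N" by (auto simp: N_def)
  have ND: "m \<in> W" "E m u" if "m \<in> N" for m using that N_def by auto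
  have acyc: "\<not> cyc E a b d" if abd: "a \<in> N" "b \<in> N" "d \<in> N" for a b d
  proof
    assume cy: "cyc E a b d"
    have sub: "{a, b, d} \<subseteq> N" using abd by auto
    show False
    proof (rule escape[OF W(1) cy sub N(1) u(1) N(2)])
      fix a b d w assume h: "cyc E a b d" "a \<in> N" "b \<in> N" "d \<in> N" "w \<in> W" "w \<notin> N"
        "E w a" "E b w" "E d w"
      have "w \<noteq> u" using h ND asym by blast
      then have "E u w" using h N_def total by blast
      then show False using notri[of w a b] h ND by blast
    next
      fix a b d w assume h: "cyc E a b d" "a \<in> N" "b \<in> N" "d \<in> N" "w \<in> W" "w \<notin> N"
        "E a w" "E w b" "E w d"
      have "w \<noteq> u" using h ND asym by blast
      then have "E u w" using h N_def total by blast
      then show False using no_U5'[of a u b d w] h ND by blast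
    qed
  qed
  have "finite N" "N \<noteq> {}" using fin t u N_def by auto
  moreover have "\<not> cyc (\<lambda>x y. E y x) a b d" if "a \<in> N" "b \<in> N" "d \<in> N" for a b d
    using acyc[of a d b] that by blast
  \<comment> \<open>A sink for the reversed arcs, so \<open>d0\<close> dominates the rest of
    \<open>N\<close>.\<close>
  ultimately obtain d0 where d0: "d0 \<in> N" "\<And>t. t \<in> N \<Longrightarrow> t \<noteq> d0 \<Longrightarrow> E d0 t"
    using tournament_rel.acyclic_sink[OF conv_tournament, of N] by blast
  obtain w w' where w: "w \<in> W" "E w d0" "w' \<in> W" "E d0 w'"
    by (rule prime_in_out[OF W(1,2) ND(1)[OF d0(1)]])
  have "w \<notin> N" "w \<noteq> u" using w d0 asym ND irrefl by metis+
  then have uw: "E u w" using w N_def total by blast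
  have we: "E w e" if "e \<in> N" for e
  proof (rule ccontr)
    assume "\<not> E w e"
    moreover have "w \<noteq> e" using that \<open>w \<notin> N\<close> by auto
    ultimately have "E e w" using total[of w e] by blast
    moreover have "e \<noteq> d0" using w \<open>\<not> E w e\<close> by auto
    ultimately show False using notri[of w d0 e] w d0 that ND uw by blast
  qed
  define c' where "c' = c(x := c u, y := c w)"
  have "x \<noteq> y" using y irrefl by metis
  then have c': "c' x = c u" "c' y = c w" "\<And>p. p \<in> W \<Longrightarrow> c' p = c p" using xy by (auto simp: c'_def)
  have "rainbow E (insert x (insert y W)) c'"
  proof (rule pair_rainbow)
    show "rainbow E (insert x W) c'"
      by (rule twin_rainbow[OF W(3) u(2) xy(1) u(1) c'(3,1)])
    show "rainbow E (insert y W) c'"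
      by (rule uniform_rainbow[OF W(3) _ xy(2) c'(3)]) (use y in \<open>auto simp: uniform_to_def\<close>)
    fix p assume p: "p \<in> W" "cyc E x y p \<or> cyc E y x p"
    have "\<not> E y x" using asym[OF y(2)] .
    then have px: "E p x" using p by blast
    then have "p \<noteq> u" using xu asym by blast
    then have "E p u" using tw p px by blast
    then have "p \<in> N" using p N_def by auto
    then have "c u \<noteq> c w \<and> c w \<noteq> c p \<and> c u \<noteq> c p" using R[of u w p] we ND uw u w by blast
    then show "c' x \<noteq> c' y \<and> c' y \<noteq> c' p \<and> c' x \<noteq> c' p" using c' p by simp
  qed
  then show thesis using that by blast
qed

lemma twin_uniform_rainbow:
  assumes W: "prime_on E W" "3 \<le> card W" "rainbow E W c" and xy: "x \<notin> W" "y \<notin> W" "x \<noteq> y"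
    and u: "u \<in> W" "twin_on E W x u" and y: "uniform_to E y W" "E y x \<noteq> E y u"
  obtains c' where "rainbow E (insert x (insert y W)) c'"
proof (cases "\<forall>p\<in>W. E y p")
  case True
  then have "E x y" using y u total xy by blast
  then show thesis using twin_uniform_rainbow_out[OF W xy(1,2) u] True that by blast
next
  case False
  then have py: "\<forall>p\<in>W. E p y" using y(1) unfolding uniform_to_def by blast
  then have "E y x" using y(2) u asym by blast
  then obtain c' where "rainbow (\<lambda>x y. E y x) (insert x (insert y W)) c'"
    using U5_free.twin_uniform_rainbow_out[OF conv, of W c x y u] W xy u py
    by (auto simp: prime_on_conv[of E] rainbow_conv[of E] twin_on_conv[of E])
  then show thesis using that rainbow_conv[of E] by blast
qed

end

context U5_T5_free
begin

text \<open>Each \<open>p\<close> between \<open>u\<close> and \<open>u'\<close> completes the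
  flipped arc to a new cyclic triangle \<open>y x p\<close>, so this is what allows \<open>x\<close>
  and \<open>y\<close> to keep the colours of \<open>u\<close> and \<open>u'\<close>. A vertex
  \<open>q\<close> closing a cyclic triangle with \<open>u u'\<close> dictates the colour of every
  such \<open>p\<close>. Without one, all other vertices lie before, between or after
  \<open>u\<close> and \<open>u'\<close>, and strong connectivity takes over.\<close>

lemma twin_pair_colours:
  assumes W: "prime_on E W" "3 \<le> card W" "rainbow E W c" and xy: "x \<notin> W" "y \<notin> W"
    and u: "u \<in> W" "twin_on E W x u" and u': "u' \<in> W" "twin_on E W y u'"
    and arcs: "E u u'" "E y x"
  shows "E u x \<and> E y u' \<and>
    (\<forall>p\<in>W. E u p \<longrightarrow> E p u' \<longrightarrow> c u \<noteq> c u' \<and> c u' \<noteq> c p \<and> c u \<noteq> c p)"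
proof -
  note R = rainbowD[OF W(3)]
  note strong = prime_strong[OF W(1,2)]
  note tx = twin_onD[OF u(2)]
  note ty = twin_onD[OF u'(2)]
  have ne: "u \<noteq> u'" "x \<noteq> u" "y \<noteq> u'" using arcs xy u u' by auto
  have ux: "E u y" "E x u'" using tx[of u'] ty[of u] u u' arcs ne by auto
  show ?thesis
  proof (cases "\<exists>q\<in>W. E u' q \<and> E q u")
    case True
    then obtain q where q: "q \<in> W" "E u' q" "E q u" by blast
    then have "q \<noteq> u" "q \<noteq> u'" by auto
    then have qq: "E q x" "E y q" using tx[of q] ty[of q] q by auto
    have "\<not> (E x u \<and> E u' y)" using no_T5[of x u u' y q] arcs ux q qq by blast
    moreover have "\<not> (E x u \<and> E y u')" using no_U5[of y u' q x u] arcs ux q qq by blast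
    moreover have "\<not> (E u x \<and> E u' y)" using no_U5[of u x u' y q] arcs ux q qq by blast
    ultimately have xx: "E u x" "E y u'" using total ne by blast+
    have cq: "c u \<noteq> c u' \<and> c u' \<noteq> c q \<and> c u \<noteq> c q" using R[of u u' q] arcs q u u' by blast
    have "c p = c q" if p: "p \<in> W" "E u p" "E p u'" for p
    proof (rule ccontr)
      assume "c p \<noteq> c q"
      then have "c p = c u \<or> c p = c u'" using cq colour_cases by metis
      have pne: "p \<noteq> u" "p \<noteq> u'" "p \<noteq> q" using p \<open>c p \<noteq> c q\<close> by auto
      then have pp: "E x p" "E p y" using tx[of p] ty[of p] p by auto
      from \<open>c p = c u \<or> c p = c u'\<close> show False
      proof
        assume cp: "c p = c u"
        then have "E q p" using R[of u p q] total[of q p] p q u pne by metis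
        then show False using no_U5'[of y u' x p q] xx ux p pp qq q arcs by blast
      next
        assume cp: "c p = c u'"
        then have "E p q" using R[of p u' q] total[of q p] p q u' pne by metis
        then show False using no_U5[of u x p y q] xx ux p pp qq q arcs by blast
      qed
    qed
    then show ?thesis using xx cq by metis
  next
    case False
    define A where "A = {a \<in> W. E a u}"
    define D where "D = {d \<in> W. E u d \<and> E d u'}"
    define B where "B = {b \<in> W. E u' b}"
    have AE: "a \<in> W" "E a u" "E a u'" "E a x" "E a y" if "a \<in> A" for a
    proof -
      have a: "a \<in> W" "E a u" using that A_def by auto
      then have "a \<noteq> u'" "a \<noteq> u" using arcs asym irrefl by metis+
      moreover then have "E a u'" using False a total by blast
      ultimately show "a \<in> W" "E a u" "E a u'" "E a x" "E a y" using a tx[of a] ty[of a] by auto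
    qed
    have BE: "b \<in> W" "E u b" "E u' b" "E x b" "E y b" if "b \<in> B" for b
    proof -
      have b: "b \<in> W" "E u' b" using that B_def by auto
      then have "b \<noteq> u" "b \<noteq> u'" using arcs asym irrefl by metis+
      moreover then have "E u b" using False b total by blast
      ultimately show "b \<in> W" "E u b" "E u' b" "E x b" "E y b" using b tx[of b] ty[of b] by auto
    qed
    have DE: "d \<in> W" "E u d" "E d u'" "E x d" "E d y" if "d \<in> D" for d
    proof -
      have d: "d \<in> W" "E u d" "E d u'" using that D_def by auto
      then have "d \<noteq> u" "d \<noteq> u'" by auto
      then show "d \<in> W" "E u d" "E d u'" "E x d" "E d y" using d tx[of d] ty[of d] by auto
    qed
    have split: "z = u \<or> z = u' \<or> z \<in> A \<or> z \<in> D \<or> z \<in> B" if "z \<in> W" for z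
      using that total[of z u] total[of z u'] unfolding A_def D_def B_def by auto
    have neq: "a \<noteq> b" "a \<noteq> d" "b \<noteq> d" if "a \<in> A" "b \<in> B" "d \<in> D" for a b d
      using AE[OF that(1)] BE[OF that(2)] DE[OF that(3)] asym by blast+
    have source: "\<not> E e d" if "d \<in> D" "a \<in> A" "E d a" "e \<in> D" "E a e" for d a e
      using flipped_arc_source[OF arcs(2), of a d e] that AE DE by blast
    have sink: "\<not> E d e" if "d \<in> D" "b \<in> B" "E b d" "e \<in> D" "E e b" for d b e
      using flipped_arc_sink[OF arcs(2), of b d e] that BE DE by blast
    have da: "E u x" if "d \<in> D" "a \<in> A" "E d a" for d a
    proof -
      have "\<not> E x u"
        using no_U5[of a y x u d] that AE[OF that(2)] DE[OF that(1)] arcs ux by blast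
      then show ?thesis using total ne by blast
    qed
    have bd: "E y u'" if "d \<in> D" "b \<in> B" "E b d" for d b
    proof -
      have "\<not> E u' y"
        using no_U5'[of x b u' y d] that BE[OF that(2)] DE[OF that(1)] arcs ux by blast
      then show ?thesis using total ne by blast
    qed
    \<comment> \<open>A backward arc would leave a single colour for \<open>u\<close>,
      \<open>u'\<close> and all of \<open>D\<close>, and the colouring would make their union
      \<open>K\<close> homogeneous.\<close>
    have ba: "\<not> E b a" if "a \<in> A" "b \<in> B" for a b
    proof
      assume ba: "E b a"
      have abd: "E a d" "E d b" if "d \<in> D" for d
        using flipped_arc_back[OF arcs(2), of a b d] ba that \<open>a \<in> A\<close> \<open>b \<in> B\<close> AE BE DE by blast+
      have cu: "c u = c u'"
        using R[of u b a] R[of u' b a] colour_cases[of "c b" "c a" "c u" "c u'"] ba that AE BE u u'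
        by metis
      have cd: "c d = c u" if "d \<in> D" for d
        using R[of u b a] R[of d b a] colour_cases[of "c b" "c a" "c u" "c d"] ba AE[OF \<open>a \<in> A\<close>]
          BE[OF \<open>b \<in> B\<close>] u abd[OF that] DE[OF that] by metis
      define K where "K = insert u (insert u' D)"
      have "a \<notin> K" using AE[OF \<open>a \<in> A\<close>] asym irrefl unfolding K_def D_def by blast
      obtain v s t where v: "v \<in> W" "v \<notin> K" "s \<in> K" "t \<in> K" "E v s" "E t v"
        by (rule prime_onD[OF W(1), of K u u' a])
          (use u u' D_def K_def ne \<open>a \<notin> K\<close> AE \<open>a \<in> A\<close> in auto)
      then have "v \<in> A \<or> v \<in> B" using split K_def by auto
      then show False
      proof
        assume vA: "v \<in> A"
        have "t \<in> D" using v AE[OF vA] asym unfolding K_def by blast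
        then show False using R[of v u t] AE[OF vA] v DE[of t] cd[of t] u by auto
      next
        assume vB: "v \<in> B"
        have "s \<in> D" using v BE[OF vB] asym unfolding K_def by blast
        then show False using R[of v s u'] BE[OF vB] v DE[of s] cd[of s] cu u' by auto
      qed
    qed
    \<comment> \<open>Otherwise nothing leaves \<open>S\<close>: by \<open>source\<close>, a vertex
      of \<open>D\<close> without arcs to \<open>A\<close> cannot dominate a vertex of
      \<open>D\<close> that has one.\<close>
    have "\<exists>d a b. d \<in> D \<and> a \<in> A \<and> b \<in> B \<and> E d a \<and> E b d"
    proof (rule ccontr)
      assume no: "\<not> ?thesis"
      define S where "S = {u'} \<union> B \<union> {d \<in> D. \<forall>a\<in>A. \<not> E d a}"
      have "u \<notin> S" using ne BE DE irrefl unfolding S_def by blast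
      have "S \<subseteq> W" using BE DE u' S_def by auto
      then obtain s z where sz: "s \<in> S" "z \<in> W" "z \<notin> S" "E s z"
        by (rule strong_onD[OF strong, of S u' u]) (use u \<open>u \<notin> S\<close> S_def in auto)
      have sE: "s = u' \<or> s \<in> B \<or> s \<in> D" using sz unfolding S_def by blast
      then have "\<not> E s u" using BE[of s] DE[of s] asym arcs by blast
      then have sA: "s \<notin> A" using AE by blast
      have "z \<noteq> u" using \<open>\<not> E s u\<close> sz by blast
      moreover have "z \<notin> A" using sz ba AE asym unfolding S_def by blast
      ultimately obtain a where z: "z \<in> D" "a \<in> A" "E z a" using split sz unfolding S_def by blast
      then have "s \<in> D" using sE sz no DE asym by blast
      then have "\<not> E s a"
        using sz(1) z(2) neq(3)[OF z(2) _ \<open>s \<in> D\<close>] DE(3)[OF \<open>s \<in> D\<close>] unfolding S_def by auto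
      then have "E a s" using total[of a s] z \<open>s \<in> D\<close> sA by blast
      then show False using source[of z a s] z \<open>s \<in> D\<close> sz by blast
    qed
    then obtain d a b where h: "d \<in> D" "a \<in> A" "b \<in> B" "E d a" "E b d" by blast
    have ab: "E a b" using ba[of a b] total[of a b] neq h by blast
    have c1: "c a \<noteq> c u \<and> c u \<noteq> c d \<and> c a \<noteq> c d" using R[of a u d] h AE DE u by blast
    have c2: "c b \<noteq> c d \<and> c d \<noteq> c u' \<and> c b \<noteq> c u'" using R[of b d u'] h BE DE u' by blast
    have c3: "c d \<noteq> c a \<and> c a \<noteq> c b \<and> c d \<noteq> c b" using R[of d a b] h AE BE DE ab by blast
    have cub: "c u = c b" "c u' = c a"
      using colour_cases[of "c d" "c a" "c b" "c u"] colour_cases[of "c d" "c a" "c b" "c u'"] c1 c2 c3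
      by auto
    have "c e = c d" if e: "e \<in> D" for e
    proof (rule ccontr)
      assume "c e \<noteq> c d"
      then have "e \<noteq> d" by auto
      have "c e = c u' \<or> c e = c u"
        using colour_cases[of "c d" "c a" "c b" "c e"] c3 cub \<open>c e \<noteq> c d\<close> by metis
      then show False
      proof
        assume ce: "c e = c u'"
        have "\<not> E e a" using R[of a u e] ce cub AE[OF h(2)] DE[OF e] u by metis
        then have "E a e" using total[of a e] neq h e by blast
        then have "E d e" using source[of d a e] h e total \<open>e \<noteq> d\<close> by blast
        then have "\<not> E e b" using sink[of d b e] h e by blast
        then have "E b e" using total[of b e] neq h e by blast
        then show False using R[of b e u'] ce BE[OF h(3)] DE[OF e] u' by metis
      next
        assume ce: "c e = c u"
        have "\<not> E b e" using R[of b e u'] ce cub BE[OF h(3)] DE[OF e] u' by metis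
        then have "E e b" using total[of b e] neq h e by blast
        then have "E e d" using sink[of d b e] h e total \<open>e \<noteq> d\<close> by blast
        then have "\<not> E a e" using source[of d a e] h e by blast
        then have "E e a" using total[of a e] neq h e by blast
        then show False using R[of a u e] ce AE[OF h(2)] DE[OF e] u by metis
      qed
    qed
    then have "c p = c d" if "p \<in> W" "E u p" "E p u'" for p using that D_def by auto
    then show ?thesis using da[of d a] bd[of d b] h c1 c2 cub c3 by metis
  qed
qed

lemma twin_pair_rainbow_out:
  assumes W: "prime_on E W" "3 \<le> card W" "rainbow E W c" and xy: "x \<notin> W" "y \<notin> W" "x \<noteq> y"
    and u: "u \<in> W" "twin_on E W x u" and u': "u' \<in> W" "twin_on E W y u'"
    and arcs: "E u u'" "E y x"
  obtains c' where "rainbow E (insert x (insert y W)) c'"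
proof -
  note K = twin_pair_colours[OF W xy(1,2) u u' arcs]
  define c' where "c' = c(x := c u, y := c u')"
  have c': "c' x = c u" "c' y = c u'" "\<And>p. p \<in> W \<Longrightarrow> c' p = c p" using xy c'_def by auto
  have "rainbow E (insert x (insert y W)) c'"
  proof (rule pair_rainbow)
    show "rainbow E (insert x W) c'"
      by (rule twin_rainbow[OF W(3) u(2) xy(1) u(1) c'(3,1)])
    show "rainbow E (insert y W) c'"
      by (rule twin_rainbow[OF W(3) u'(2) xy(2) u'(1) c'(3,2)])
    fix p assume p: "p \<in> W" "cyc E x y p \<or> cyc E y x p"
    then have yxp: "E x p" "E p y" using arcs asym by blast+
    then have "p \<noteq> u" "p \<noteq> u'" using K asym by blast+
    then have "E u p" "E p u'" using twin_onD[OF u(2)] twin_onD[OF u'(2)] p yxp by blast+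
    then show "c' x \<noteq> c' y \<and> c' y \<noteq> c' p \<and> c' x \<noteq> c' p" using c' p K by simp
  qed
  then show thesis using that by blast
qed

lemma twin_pair_rainbow:
  assumes W: "prime_on E W" "3 \<le> card W" "rainbow E W c" and xy: "x \<notin> W" "y \<notin> W" "x \<noteq> y"
    and u: "u \<in> W" "twin_on E W x u" and u': "u' \<in> W" "twin_on E W y u'" "u' \<noteq> u"
    and dist: "E y x \<noteq> E y u"
  obtains c' where "rainbow E (insert x (insert y W)) c'"
proof (cases "E u u'")
  case True
  then have "\<not> E y u" using twin_onD(1)[OF u'(2) u(1)] u' asym by auto
  then show thesis using twin_pair_rainbow_out[OF W xy u u'(1,2) True] dist that by blast
next
  case False
  then have 1: "E u' u" using total u' by blast
  then have "E y u" using twin_onD(1)[OF u'(2) u(1)] u' by auto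
  then have 2: "E x y" using dist total xy by blast
  show thesis
    using twin_pair_rainbow_out[OF W xy(2,1) xy(3)[symmetric] u'(1,2) u 1 2] that
    by (metis insert_commute)
qed

theorem prime_rainbow:
  assumes V: "prime_on E V"
  obtains c where "rainbow E V c"
proof (cases "\<exists>a\<in>V. \<exists>b\<in>V. \<exists>d\<in>V. cyc E a b d")
  case False
  then have "rainbow E V (\<lambda>_. Red)" unfolding rainbow_def by blast
  then show thesis using that by blast
next
  case True
  then obtain a b d where t: "a \<in> V" "b \<in> V" "d \<in> V" "cyc E a b d" by blast
  have fin: "finite V" using V unfolding prime_on_def by blast
  define \<W> where "\<W> = {W. W \<subseteq> V \<and> prime_on E W \<and> 3 \<le> card W \<and> (\<exists>c. rainbow E W c)}"
  have ne: "a \<noteq> b" "b \<noteq> d" "a \<noteq> d" using t by auto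
  have "prime_on E {a, b, d}"
  proof (rule prime_onI)
    fix I s s' z
    assume I: "I \<subseteq> {a, b, d}" "s \<in> I" "s' \<in> I" "s \<noteq> s'" "z \<in> {a, b, d}" "z \<notin> I"
      and hom: "\<And>v x y. v \<in> {a, b, d} \<Longrightarrow> v \<notin> I \<Longrightarrow> x \<in> I \<Longrightarrow> y \<in> I \<Longrightarrow> E v x \<Longrightarrow> E v y"
    have "E z s \<longleftrightarrow> E z s'" using hom I by blast
    moreover have "E z s \<longleftrightarrow> \<not> E z s'" using I t ne asym by auto
    ultimately show False by blast
  qed auto
  moreover have "rainbow E {a, b, d} (\<lambda>v. if v = a then Red else if v = b then Green else Blue)"
    using t ne unfolding rainbow_def by auto
  ultimately have "{a, b, d} \<in> \<W>" using t ne unfolding \<W>_def by auto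
  moreover have "finite \<W>" using fin unfolding \<W>_def by simp
  ultimately obtain W where W: "W \<in> \<W>" and max: "\<And>W'. W' \<in> \<W> \<Longrightarrow> W \<subseteq> W' \<Longrightarrow> W' = W"
    using finite_has_maximal2 by metis
  then obtain c where W': "W \<subseteq> V" "prime_on E W" "3 \<le> card W" "rainbow E W c"
    unfolding \<W>_def by blast
  have finW: "finite W" using W' fin finite_subset by blast
  have ext: False if "W \<subset> W'" "W' \<subseteq> V" "prime_on E W'" "rainbow E W' c'" for W' c'
  proof -
    have "card W \<le> card W'" using that fin by (meson card_mono finite_subset psubset_imp_subset)
    then show False using max[of W'] that W' unfolding \<W>_def by auto
  qed
  have kind: "uniform_to E x W \<or> (\<exists>u\<in>W. twin_on E W x u)" if x: "x \<in> V" "x \<notin> W" for x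
  proof (rule ccontr)
    assume no: "\<not> ?thesis"
    obtain k where "rainbow E (insert x W) (c(x := k))" using one_vertex_colouring[OF W'(2-4) x(2)] .
    moreover have "prime_on E (insert x W)" using prime_insert[OF W'(2) x(2)] no by blast
    moreover have "W \<subset> insert x W" "insert x W \<subseteq> V" using x W' by auto
    ultimately show False using ext by blast
  qed
  show thesis
  proof (cases "W = V")
    case True
    then show thesis using W' that by blast
  next
    case False
    then obtain z where z: "z \<in> V" "z \<notin> W" using W' by blast
    obtain w w' where w: "w \<in> W" "w' \<in> W" "w \<noteq> w'"
      using third_vertex[OF W'(3)] by metis
    obtain x s t where x: "x \<in> V" "x \<notin> W" "s \<in> W" "t \<in> W" "E x s" "E t x"
      by (rule prime_onD[OF V W'(1) w z])
    then have "\<not> uniform_to E x W" using asym unfolding uniform_to_def by blast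
    then obtain u where u: "u \<in> W" "twin_on E W x u" using kind x by blast
    \<comment> \<open>\<open>U\<close> is the twin class of \<open>u\<close>. A vertex
      \<open>y\<close> splitting it lies outside \<open>W\<close>, because twins of \<open>u\<close>
      agree on the rest of \<open>W\<close>, and it separates some twin \<open>x'\<close> from
      \<open>u\<close>.\<close>
    define U where "U = insert u {v \<in> V. v \<notin> W \<and> twin_on E W v u}"
    have U: "U \<subseteq> V" "x \<in> U" "u \<in> U" "x \<noteq> u" using u x W' U_def by auto
    obtain q where q: "q \<in> W" "q \<noteq> u" using w by metis
    then have "q \<in> V" "q \<notin> U" using W' U_def by auto
    then obtain y s t where y: "y \<in> V" "y \<notin> U" "s \<in> U" "t \<in> U" "E y s" "E t y"
      using prime_onD[OF V U(1,2,3,4)] by blast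
    then have "\<not> E y t" using asym by blast
    then have "\<exists>x'\<in>U. E y x' \<noteq> E y u" using y by blast
    then obtain x' where x': "x' \<in> U" "E y x' \<noteq> E y u" by blast
    then have x'': "x' \<in> V" "x' \<notin> W" "twin_on E W x' u" unfolding U_def by auto
    have "y \<noteq> u" using y U_def by auto
    have yW: "y \<notin> W" using twin_onD(2)[OF x''(3), of y] x' \<open>y \<noteq> u\<close> by blast
    have yx: "x' \<noteq> y" using x' y by auto
    have "\<not> twin_on E W y u" using y yW U_def by auto
    then have ky: "uniform_to E y W \<or> (\<exists>u'\<in>W. u' \<noteq> u \<and> twin_on E W y u')"
      using kind[OF y(1) yW] by metis
    have pr: "prime_on E (insert x' (insert y W))"
      by (rule prime_insert_twin[OF W'(2,3) x''(2) yW yx u(1) x''(3) x'(2) ky])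
    obtain c' where "rainbow E (insert x' (insert y W)) c'"
      using ky
    proof (elim disjE bexE conjE)
      assume "uniform_to E y W"
      then show thesis
        using twin_uniform_rainbow[OF W'(2-4) x''(2) yW yx u(1) x''(3) _ x'(2)] that by blast
    next
      fix u' assume "u' \<in> W" "u' \<noteq> u" "twin_on E W y u'"
      then show thesis
        using twin_pair_rainbow[OF W'(2-4) x''(2) yW yx u(1) x''(3) _ _ _ x'(2)] that by blast
    qed
    moreover have "W \<subset> insert x' (insert y W)" "insert x' (insert y W) \<subseteq> V"
      using x'' y W' by auto
    ultimately show thesis using ext pr by blast
  qed
qed

end

section \<open>Tournaments containing \<open>T\<^sub>5\<close>\<close>

definition T5_at :: "('a \<Rightarrow> 'a \<Rightarrow> bool) \<Rightarrow> 'a \<Rightarrow> 'a \<Rightarrow> 'a \<Rightarrow> 'a \<Rightarrow> 'a \<Rightarrow> bool" where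
  "T5_at E a b c d e \<longleftrightarrow>
    E a b \<and> E a c \<and> E b c \<and> E b d \<and> E c d \<and> E c e \<and> E d e \<and> E d a \<and> E e a \<and> E e b"

text \<open>The vertex \<open>p\<close> may replace \<open>a\<close> in a copy \<open>a b c d e\<close> of \<open>T\<^sub>5\<close>; the arc between \<open>a\<close> and \<open>p\<close> is
  arbitrary, and \<open>p = a\<close> is allowed.\<close>

definition like_first :: "('a \<Rightarrow> 'a \<Rightarrow> bool) \<Rightarrow> 'a \<Rightarrow> 'a \<Rightarrow> 'a \<Rightarrow> 'a \<Rightarrow> 'a \<Rightarrow> bool" where
  "like_first E b c d e p \<longleftrightarrow> E p b \<and> E p c \<and> E d p \<and> E e p"

text \<open>Rotation lets \<open>swap\<close> act on every position although it names only the
  first, and brings every vertex of a reached copy to the front.\<close>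

inductive T5_reach :: "('a \<Rightarrow> 'a \<Rightarrow> bool) \<Rightarrow> 'a set \<Rightarrow> 'a \<Rightarrow> 'a \<Rightarrow> 'a \<Rightarrow> 'a \<Rightarrow> 'a
    \<Rightarrow> 'a \<Rightarrow> 'a \<Rightarrow> 'a \<Rightarrow> 'a \<Rightarrow> 'a \<Rightarrow> bool" for E V a0 b0 c0 d0 e0 where
  base: "T5_reach E V a0 b0 c0 d0 e0 a0 b0 c0 d0 e0"
| rotate: "T5_reach E V a0 b0 c0 d0 e0 a b c d e \<Longrightarrow> T5_reach E V a0 b0 c0 d0 e0 b c d e a"
| swap: "T5_reach E V a0 b0 c0 d0 e0 a b c d e \<Longrightarrow> p \<in> V \<Longrightarrow> like_first E b c d e p \<Longrightarrow>
    T5_reach E V a0 b0 c0 d0 e0 p b c d e"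

lemma T5_rotate: "T5_at E a b c d e \<Longrightarrow> T5_at E b c d e a"
  unfolding T5_at_def by auto

lemma T5_first: "T5_at E a b c d e \<Longrightarrow> like_first E b c d e a"
  unfolding T5_at_def like_first_def by auto

lemma T5_swap: "T5_at E a b c d e \<Longrightarrow> like_first E b c d e p \<Longrightarrow> T5_at E p b c d e"
  unfolding T5_at_def like_first_def by auto

lemma T5_conv: "T5_at (\<lambda>x y. E y x) a b c d e \<longleftrightarrow> T5_at E e d c b a"
  unfolding T5_at_def by auto

context U5_free
begin

lemma T5_no_out:
  assumes "T5_at E a b c d e" "E p a" "E b p" "E c p"
  shows "\<not> E e p"
  using no_U5[of e p a b c] assms unfolding T5_at_def by metis

lemma T5_no_in:
  assumes "T5_at E a b c d e" "E a p" "E p b" "E p d"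
  shows "\<not> E p e"
  using no_U5'[of p b e a d] assms unfolding T5_at_def by metis

text \<open>For \<open>p\<close> outside the copy, the rotations of \<open>T5_no_out\<close> and
  \<open>T5_no_in\<close> exclude 20 of the 32 arc patterns. The other twelve are the source, the
  sink and, for each vertex of the copy, the two patterns that differ only in the arc to it.\<close>

lemma T5_extension:
  assumes T: "T5_at E a b c d e"
  shows "(E p a \<and> E p b \<and> E p c \<and> E p d \<and> E p e) \<or> (E a p \<and> E b p \<and> E c p \<and> E d p \<and> E e p) \<or>
    like_first E b c d e p \<or> like_first E c d e a p \<or> like_first E d e a b p \<or>
    like_first E e a b c p \<or> like_first E a b c d p"
proof -
  note T1 = T5_rotate[OF T] note T2 = T5_rotate[OF T1] note T3 = T5_rotate[OF T2]
  note T4 = T5_rotate[OF T3]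
  show ?thesis
  proof (cases "p = a \<or> p = b \<or> p = c \<or> p = d \<or> p = e")
    case True
    then show ?thesis
      using T5_first[OF T] T5_first[OF T1] T5_first[OF T2] T5_first[OF T3] T5_first[OF T4] by metis
  next
    case False
    have "E v p \<longleftrightarrow> \<not> E p v" if "p \<noteq> v" for v
      using total[OF that] asym by blast
    with False have iff: "E a p \<longleftrightarrow> \<not> E p a" "E b p \<longleftrightarrow> \<not> E p b" "E c p \<longleftrightarrow> \<not> E p c"
      "E d p \<longleftrightarrow> \<not> E p d" "E e p \<longleftrightarrow> \<not> E p e"
      by simp_all
    note out = T5_no_out[OF T, of p] T5_no_out[OF T1, of p] T5_no_out[OF T2, of p]
      T5_no_out[OF T3, of p] T5_no_out[OF T4, of p]
    note inn = T5_no_in[OF T, of p] T5_no_in[OF T1, of p] T5_no_in[OF T2, of p]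
      T5_no_in[OF T3, of p] T5_no_in[OF T4, of p]
    show ?thesis
      using out inn unfolding like_first_def iff
      by argo
  qed
qed

lemma T5_reach_T5:
  assumes "T5_reach E V a0 b0 c0 d0 e0 a b c d e" "T5_at E a0 b0 c0 d0 e0" "{a0, b0, c0, d0, e0} \<subseteq> V"
  shows "T5_at E a b c d e \<and> {a, b, c, d, e} \<subseteq> V"
  using assms
proof (induction rule: T5_reach.induct)
  case (rotate a b c d e)
  then show ?case using T5_rotate[of E a b c d e] by auto
next
  case (swap a b c d e p)
  then show ?case using T5_swap[of E a b c d e p] by auto
qed auto

text \<open>The vertices of all copies of \<open>T\<^sub>5\<close> reached from one copy by replacing vertices one at a time
  form a homogeneous set.\<close>

lemma T5_reach_all:
  assumes V: "prime_on E V" and T: "T5_at E a0 b0 c0 d0 e0" "{a0, b0, c0, d0, e0} \<subseteq> V" and z: "z \<in> V"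
  obtains b c d e where "T5_reach E V a0 b0 c0 d0 e0 z b c d e"
proof -
  let ?R = "T5_reach E V a0 b0 c0 d0 e0"
  define M where "M = {z. \<exists>b c d e. ?R z b c d e}"
  note RT = T5_reach_T5[OF _ T]
  have base: "?R a0 b0 c0 d0 e0" by (rule T5_reach.base)
  have "M \<subseteq> V"
  proof
    fix z assume "z \<in> M"
    then obtain b c d e where "?R z b c d e" unfolding M_def by auto
    from RT[OF this] show "z \<in> V" by auto
  qed
  moreover have "a0 \<in> M" using base unfolding M_def by auto
  moreover have "b0 \<in> M" using T5_reach.rotate[OF base] unfolding M_def by auto
  ultimately have M: "M \<subseteq> V" "a0 \<in> M" "b0 \<in> M" by auto
  have "a0 \<noteq> b0" using T unfolding T5_at_def by auto
  have "z \<in> M"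
  proof (rule ccontr)
    assume "z \<notin> M"
    obtain v x y where v: "v \<in> V" "v \<notin> M" "x \<in> M" "y \<in> M" "E v x" "E y v"
      by (rule prime_onD[OF V M \<open>a0 \<noteq> b0\<close> z \<open>z \<notin> M\<close>])
    have no: "\<not> like_first E b c d e v" if "?R a b c d e" for a b c d e
      using T5_reach.swap[OF that v(1)] v(2) unfolding M_def by auto
    have ext: "(E v a \<and> E v b \<and> E v c \<and> E v d \<and> E v e) \<or> (E a v \<and> E b v \<and> E c v \<and> E d v \<and> E e v)"
      if r: "?R a b c d e" for a b c d e
    proof -
      note r1 = T5_reach.rotate[OF r] note r2 = T5_reach.rotate[OF r1]
      note r3 = T5_reach.rotate[OF r2] note r4 = T5_reach.rotate[OF r3]
      show ?thesis
        using T5_extension[of a b c d e v] RT[OF r] no[OF r] no[OF r1] no[OF r2] no[OF r3] no[OF r4]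
        by blast
    qed
    \<comment> \<open>By \<open>ext\<close>, \<open>v\<close> is uniform to each reached copy; a
      swap keeps four vertices, so the direction never changes.\<close>
    have "E v a \<longleftrightarrow> E v a0" if "?R a b c d e" for a b c d e
      using that
    proof (induction rule: T5_reach.induct)
      case (rotate a b c d e)
      then show ?case using ext[of a b c d e] asym by blast
    next
      case (swap a b c d e p)
      then show ?case using ext[of a b c d e] ext[OF T5_reach.swap[OF swap(1-3)]] asym by blast
    qed auto
    then show False using v asym unfolding M_def by blast
  qed
  then show thesis using that unfolding M_def by blast
qed

text \<open>A swap preserves the sink: when four arcs enter \<open>z\<close>,
  \<open>T5_extension\<close> makes the fifth enter as well. But some reached copy contains
  \<open>z\<close> itself.\<close>

lemma T5_no_sink:
  assumes "prime_on E V" "T5_at E a b c d e" "{a, b, c, d, e} \<subseteq> V" "z \<in> V"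
  shows "\<not> (E a z \<and> E b z \<and> E c z \<and> E d z \<and> E e z)"
proof
  assume sink: "E a z \<and> E b z \<and> E c z \<and> E d z \<and> E e z"
  have "E a' z \<and> E b' z \<and> E c' z \<and> E d' z \<and> E e' z" if "T5_reach E V a b c d e a' b' c' d' e'"
    for a' b' c' d' e'
    using that
  proof (induction rule: T5_reach.induct)
    case (swap a' b' c' d' e' p)
    have "T5_at E p b' c' d' e'"
      using T5_reach_T5[OF T5_reach.swap[OF swap(1-3)] assms(2,3)] by blast
    then show ?case
      using T5_extension[of p b' c' d' e' z] swap asym unfolding like_first_def by blast
  qed (use sink in auto)
  moreover obtain b' c' d' e' where "T5_reach E V a b c d e z b' c' d' e'"
    using T5_reach_all[OF assms] .
  ultimately show False using irrefl by blast
qed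

lemma T5_no_source:
  assumes "prime_on E V" "T5_at E a b c d e" "{a, b, c, d, e} \<subseteq> V" "z \<in> V"
  shows "\<not> (E z a \<and> E z b \<and> E z c \<and> E z d \<and> E z e)"
proof -
  have "prime_on (\<lambda>x y. E y x) V" using assms by (simp add: prime_on_conv[of E])
  moreover have "T5_at (\<lambda>x y. E y x) e d c b a" using assms(2) by (simp add: T5_conv[of E])
  ultimately show ?thesis using U5_free.T5_no_sink[OF conv, of V e d c b a z] assms by blast
qed

lemma T5_classes:
  assumes "prime_on E V" "T5_at E a b c d e" "{a, b, c, d, e} \<subseteq> V" "p \<in> V"
  shows "like_first E b c d e p \<or> like_first E c d e a p \<or> like_first E d e a b p \<or>
    like_first E e a b c p \<or> like_first E a b c d p"
  using T5_extension[OF assms(2), of p] T5_no_sink[OF assms] T5_no_source[OF assms] by blast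

text \<open>A vertex \<open>w\<close> splitting the class of \<open>a\<close> cannot resemble
  \<open>a\<close>, \<open>b\<close> or \<open>e\<close>. If it resembles \<open>c\<close> or
  \<open>d\<close>, then \<open>E b w\<close> and \<open>E w e\<close>, and a triangle of the class
  split by \<open>w\<close> forms \<open>U\<^sub>5\<close> with \<open>w\<close> and one of
  \<open>b\<close>, \<open>e\<close>.\<close>

lemma T5_class_acyclic:
  assumes V: "prime_on E V" and T: "T5_at E a b c d e" "{a, b, c, d, e} \<subseteq> V"
    and t: "{t, t', t''} \<subseteq> V" "like_first E b c d e t" "like_first E b c d e t'" "like_first E b c d e t''"
  shows "\<not> cyc E t t' t''"
proof
  assume cy: "cyc E t t' t''"
  define P where "P = {p \<in> V. like_first E b c d e p}"
  have PD: "p \<in> V" "T5_at E p b c d e" if "p \<in> P" for p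
    using T5_swap[OF T(1)] that P_def by auto
  have P: "{t, t', t''} \<subseteq> P" "P \<subseteq> V" "b \<in> V" "b \<notin> P"
    using t T by (auto simp: P_def like_first_def)
  have mixed: "(\<exists>p\<in>P. \<not> E w p) \<and> (\<exists>p\<in>P. \<not> E p w) \<Longrightarrow>
      E w e \<and> E b w" if w: "w \<in> V" "w \<notin> P" for w
  proof -
    assume mix: "(\<exists>p\<in>P. \<not> E w p) \<and> (\<exists>p\<in>P. \<not> E p w)"
    have wp: "w \<noteq> p" if "p \<in> P" for p using w that by auto
    have 1: "E p w" if "like_first E c d e a w" "p \<in> P" for p
    proof -
      have "T5_at E e p b c d" using T5_rotate PD(2)[OF that(2)] by metis
      then have "\<not> E w p" using T5_no_in[of e p b c d w] that(1) unfolding like_first_def by blast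
      then show ?thesis using total wp[OF that(2)] by blast
    qed
    have 2: "E w p" if "like_first E a b c d w" "p \<in> P" for p
    proof -
      have "T5_at E b c d e p" using T5_rotate PD(2)[OF that(2)] by metis
      then have "\<not> E p w" using T5_no_out[of b c d e p w] that(1) unfolding like_first_def by blast
      then show ?thesis using total wp[OF that(2)] by blast
    qed
    show "E w e \<and> E b w"
      using T5_classes[OF V T w(1)]
    proof (elim disjE)
      assume "like_first E b c d e w"
      then show ?thesis using w P_def by auto
    next
      assume "like_first E c d e a w"
      then show ?thesis using mix 1 by auto
    next
      assume "like_first E a b c d w"
      then show ?thesis using mix 2 by auto
    qed (auto simp: like_first_def)
  qed
  have eb: "E e p" "E p b" if "p \<in> P" for p using PD(2)[OF that] unfolding T5_at_def by auto
  show False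
  proof (rule escape[OF V cy P])
    fix t t' t'' w assume h: "cyc E t t' t''" "t \<in> P" "t' \<in> P" "t'' \<in> P" "w \<in> V" "w \<notin> P"
      "E w t" "E t' w" "E t'' w"
    then have "E w e \<and> E b w" using mixed[of w] asym by blast
    then show False using no_U5[of e t t' t'' w] h eb by blast
  next
    fix t t' t'' w assume h: "cyc E t t' t''" "t \<in> P" "t' \<in> P" "t'' \<in> P" "w \<in> V" "w \<notin> P"
      "E t w" "E w t'" "E w t''"
    then have "E w e \<and> E b w" using mixed[of w] asym by blast
    then show False using no_U5'[of t b t' t'' w] h eb by blast
  qed
qed

text \<open>The out-neighbours of \<open>a\<close> resemble \<open>a\<close>, \<open>b\<close> or
  \<open>c\<close>. Each of these classes is acyclic, and among out-neighbours of \<open>a\<close>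
  no arc runs back against this order.\<close>

lemma T5_first_out_acyclic:
  assumes V: "prime_on E V" and T: "T5_at E a b c d e" "{a, b, c, d, e} \<subseteq> V"
    and t: "{t, t', t''} \<subseteq> V" "E a t" "E a t'" "E a t''"
  shows "\<not> cyc E t t' t''"
proof -
  note T1 = T5_rotate[OF T(1)] note T2 = T5_rotate[OF T1]
  have cls: "like_first E b c d e s \<or> like_first E c d e a s \<or> like_first E d e a b s"
    if "s \<in> V" "E a s" for s
    using T5_classes[OF V T that(1)] that asym unfolding like_first_def by blast
  have 1: "\<not> E s' s" if "like_first E b c d e s" "like_first E c d e a s'" for s s'
  proof -
    have "T5_at E e s b c d" using T5_rotate T5_swap[OF T(1) that(1)] by metis
    then show ?thesis using T5_no_in[of e s b c d s'] that unfolding like_first_def by blast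
  qed
  have 2: "\<not> E s' s" if "like_first E c d e a s" "like_first E d e a b s'" for s s'
  proof -
    have "T5_at E a s c d e" using T5_rotate T5_swap[OF T1 that(1)] by metis
    then show ?thesis using T5_no_in[of a s c d e s'] that unfolding like_first_def by blast
  qed
  have 3: "\<not> E s' s" if "like_first E b c d e s" "like_first E d e a b s'" "E a s" for s s'
  proof -
    have "T5_at E b s' d e a" using T5_rotate T5_swap[OF T2 that(2)] by metis
    then show ?thesis using T5_no_out[of b s' d e a s] that unfolding like_first_def by blast
  qed
  have V': "{b, c, d, e, a} \<subseteq> V" "{c, d, e, a, b} \<subseteq> V" using T by auto
  have "{t, t', t''} \<subseteq> V" by (rule t(1))
  note ac = T5_class_acyclic[OF V T this] T5_class_acyclic[OF V T1 V'(1) this]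
    T5_class_acyclic[OF V T2 V'(2) this]
  have tV: "t \<in> V" "t' \<in> V" "t'' \<in> V" using t by auto
  show ?thesis
    using cls[OF tV(1) t(2)] cls[OF tV(2) t(3)] cls[OF tV(3) t(4)]
    by (elim disjE) (use 1 2 3 t(2-4) ac in metis)+
qed

lemma T5_prime_out_acyclic:
  assumes V: "prime_on E V" and T: "T5_at E a b c d e" "{a, b, c, d, e} \<subseteq> V"
    and t: "{v, t, t', t''} \<subseteq> V" "E v t" "E v t'" "E v t''"
  shows "\<not> cyc E t t' t''"
proof -
  have "v \<in> V" "{t, t', t''} \<subseteq> V" using t by auto
  obtain b' c' d' e' where r: "T5_reach E V a b c d e v b' c' d' e'"
    using T5_reach_all[OF V T \<open>v \<in> V\<close>] .
  have "T5_at E v b' c' d' e'" "{v, b', c', d', e'} \<subseteq> V"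
    using T5_reach_T5[OF r T] by auto
  then show ?thesis
    by (rule T5_first_out_acyclic[OF V _ _ \<open>{t, t', t''} \<subseteq> V\<close> t(2-4)])
qed

lemma T5_prime_in_acyclic:
  assumes V: "prime_on E V" and T: "T5_at E a b c d e" "{a, b, c, d, e} \<subseteq> V"
    and t: "{v, t, t', t''} \<subseteq> V" "E t v" "E t' v" "E t'' v"
  shows "\<not> cyc E t t' t''"
proof -
  have "prime_on (\<lambda>x y. E y x) V" using assms by (simp add: prime_on_conv[of E])
  moreover have "T5_at (\<lambda>x y. E y x) e d c b a" using T by (simp add: T5_conv[of E])
  ultimately show ?thesis
    using U5_free.T5_prime_out_acyclic[OF conv, of V e d c b a v t t'' t'] T t by blast
qed

end

section \<open>Locally transitive tournaments\<close>

definition locally_transitive_on :: "('a \<Rightarrow> 'a \<Rightarrow> bool) \<Rightarrow> 'a set \<Rightarrow> bool" where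
  "locally_transitive_on E V \<longleftrightarrow> (\<forall>v\<in>V. \<forall>a\<in>V. \<forall>b\<in>V. \<forall>c\<in>V. cyc E a b c \<longrightarrow>
     \<not> (E v a \<and> E v b \<and> E v c) \<and> \<not> (E a v \<and> E b v \<and> E c v))"

lemma locally_transitive_on_conv:
  "locally_transitive_on (\<lambda>x y. E y x) V \<longleftrightarrow> locally_transitive_on E V"
proof -
  have conv: "locally_transitive_on (\<lambda>x y. R y x) V" if "locally_transitive_on R V" for R
    unfolding locally_transitive_on_def
  proof (intro ballI impI)
    fix v a b c assume "v \<in> V" "a \<in> V" "b \<in> V" "c \<in> V" "cyc (\<lambda>x y. R y x) a b c"
    then show "\<not> (R a v \<and> R b v \<and> R c v) \<and> \<not> (R v a \<and> R v b \<and> R v c)"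
      using that[unfolded locally_transitive_on_def, rule_format, of v a c b] by blast
  qed
  show ?thesis using conv[of E] conv[of "\<lambda>x y. E y x"] by auto
qed

text \<open>Both indices lie in one period, so the congruence wraps around at most once: quotient 0
  is the first alternative and quotient -1 the second.\<close>

lemma circular_arc_iff:
  assumes "a \<in> {1..2 * k + 1}" "b \<in> {1..2 * k + 1}"
  shows "(\<exists>d\<in>{1..k}. [int b - int a = int d] (mod int (2 * k + 1))) \<longleftrightarrow>
    a < b \<and> b \<le> a + k \<or> b + k < a" (is "?L \<longleftrightarrow> ?R")
proof
  assume ?L
  then obtain d where d: "1 \<le> d" "d \<le> k" "int (2 * k + 1) dvd int b - int a - int d"
    by (auto simp: cong_iff_dvd_diff)
  then obtain q where q: "int b - int a - int d = int (2 * k + 1) * q" by (auto simp: dvd_def)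
  define N where "N = int (2 * k + 1)"
  have N: "N = 2 * int k + 1" "N > 0" "int b \<le> N" "int a \<le> N" "1 \<le> int a" "1 \<le> int b"
    "1 \<le> int d" "int d \<le> int k"
    using assms d by (auto simp: N_def)
  have q': "N * q = int b - int a - int d" using q by (simp only: N_def)
  have "N * q < N * 1" unfolding q' using N by linarith
  then have "q < 1" using N(2) by (simp only: mult_less_cancel_left_pos)
  have "N * (-2) < N * q" unfolding q' using N by linarith
  then have "-2 < q" using N(2) by (simp only: mult_less_cancel_left_pos)
  then have "q = 0 \<or> q = -1" using \<open>q < 1\<close> by linarith
  then show ?R using q d assms by auto
next
  assume ?R
  then show ?L
  proof
    assume h: "a < b \<and> b \<le> a + k"
    then have "[int b - int a = int (b - a)] (mod int (2 * k + 1))" by (simp add: of_nat_diff)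
    then show ?L using h by (intro bexI[of _ "b - a"]) auto
  next
    assume h: "b + k < a"
    then have "int b - int a - int (b + (2 * k + 1) - a) = - int (2 * k + 1)"
      using assms by (simp add: of_nat_diff)
    then have "[int b - int a = int (b + (2 * k + 1) - a)] (mod int (2 * k + 1))"
      by (simp only: cong_iff_dvd_diff dvd_minus_iff dvd_refl)
    then show ?L using h assms by (intro bexI[of _ "b + (2 * k + 1) - a"]) auto
  qed
qed

context tournament_rel
begin

lemma strict_mono_into_lessThan:
  assumes "finite S" and f: "\<And>x y. x \<in> S \<Longrightarrow> y \<in> S \<Longrightarrow> E x y \<Longrightarrow> f x < (f y :: nat)"
    and bound: "\<And>x. x \<in> S \<Longrightarrow> f x < k"
  shows "card S \<le> k" and "card S = k \<Longrightarrow> bij_betw f S {..<k}"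
proof -
  have inj: "inj_on f S" using f total by (metis inj_onI less_irrefl)
  have sub: "f ` S \<subseteq> {..<k}" using bound by auto
  show "card S \<le> k" using card_inj_on_le[OF inj sub] by simp
  assume "card S = k"
  then have "f ` S = {..<k}" using card_subset_eq[OF _ sub] card_image[OF inj] by simp
  then show "bij_betw f S {..<k}" using inj by (simp add: bij_betw_def)
qed

lemma transitive_rank:
  assumes "finite S" and acyc: "\<And>a b c. a \<in> S \<Longrightarrow> b \<in> S \<Longrightarrow> c \<in> S \<Longrightarrow> \<not> cyc E a b c"
    and x: "x \<in> S" "y \<in> S" "E x y"
  shows "card {z \<in> S. E z x} < card {z \<in> S. E z y}"
proof (rule psubset_card_mono)
  show "finite {z \<in> S. E z y}" using assms(1) by simp
  have "E z y" if "z \<in> S" "E z x" for z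
    using acyc[OF that(1) x(1,2)] total[of z y] asym[of z x] that x by metis
  moreover have "x \<in> {z \<in> S. E z y}" "x \<notin> {z \<in> S. E z x}" using x by auto
  ultimately show "{z \<in> S. E z x} \<subset> {z \<in> S. E z y}" by blast
qed

text \<open>If \<open>i\<close> dominates an out-neighbour \<open>z\<close> of \<open>v\<close>, so
  does \<open>j\<close>, as otherwise \<open>i\<close> would dominate the cyclic triangle
  \<open>v z j\<close>. Strictness is primality: for equal sets, \<open>i\<close>, \<open>j\<close>
  and the in-neighbours of \<open>v\<close> between them would be homogeneous.\<close>

lemma locally_transitive_strict_mono:
  assumes V: "prime_on E V" "locally_transitive_on E V" "v \<in> V"
    and i: "i \<in> V" "E i v" "j \<in> V" "E j v" "E i j"
  shows "card {z \<in> V. E v z \<and> E i z} < card {z \<in> V. E v z \<and> E j z}"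
proof -
  have fin: "finite V" using V unfolding prime_on_def by blast
  have lt: "\<not> (E w a \<and> E w b \<and> E w c)" "\<not> (E a w \<and> E b w \<and> E c w)"
    if "w \<in> V" "a \<in> V" "b \<in> V" "c \<in> V" "cyc E a b c" for w a b c
    using V(2) that unfolding locally_transitive_on_def by blast+
  have mono: "E q z" if "p \<in> V" "E p v" "q \<in> V" "E q v" "E p q" "z \<in> V" "E v z" "E p z" for p q z
  proof (rule ccontr)
    assume "\<not> E q z"
    moreover have "q \<noteq> z" using that asym by blast
    ultimately have "cyc E v z q" using total that by blast
    then show False using lt(1)[of p v z q] that V(3) by blast
  qed
  have itrans: "E p r" if "p \<in> V" "E p v" "q \<in> V" "E q v" "r \<in> V" "E r v" "E p q" "E q r" for p q r
    using lt(2)[of v p q r] that V(3) total[of p r] asym[of p q] by metis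
  have "{z \<in> V. E v z \<and> E i z} \<noteq> {z \<in> V. E v z \<and> E j z}"
  proof
    assume eq: "{z \<in> V. E v z \<and> E i z} = {z \<in> V. E v z \<and> E j z}"
    define K where "K = {i, j} \<union> {p \<in> V. E p v \<and> E i p \<and> E p j}"
    have K: "K \<subseteq> V" "i \<in> K" "j \<in> K" "i \<noteq> j" using i by (auto simp: K_def)
    have Kv: "E p v" "p \<in> V" if "p \<in> K" for p using that i by (auto simp: K_def)
    have ij: "p = i \<or> E i p" "p = j \<or> E p j" if "p \<in> K" for p using that i by (auto simp: K_def)
    have "v \<notin> K" using Kv irrefl by blast
    then obtain w p q where w: "w \<in> V" "w \<notin> K" "p \<in> K" "q \<in> K" "E w p" "E q w"
      using prime_onD[OF V(1) K V(3)] by blast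
    show False
    proof (cases "E v w")
      case True
      have iw: "E i w \<Longrightarrow> E p w" using ij(1)[OF w(3)] mono[of i p w] Kv[OF w(3)] i w True by blast
      have "E j w" using ij(2)[OF w(4)] mono[of q j w] Kv[OF w(4)] i w True by blast
      then have "E i w" using eq w True by blast
      then show False using iw asym w by blast
    next
      case False
      have "w \<noteq> v" using w(5) Kv(1)[OF w(3)] w(6) Kv(1)[OF w(4)] asym by blast
      then have wv: "E w v" using False total by blast
      have "E w j" using ij(2)[OF w(3)] itrans[of w p j] Kv[OF w(3)] i w wv by blast
      moreover have "E i w" using ij(1)[OF w(4)] itrans[of i q w] Kv[OF w(4)] i w wv by blast
      ultimately show False using w wv by (auto simp: K_def)
    qed
  qed
  moreover have "{z \<in> V. E v z \<and> E i z} \<subseteq> {z \<in> V. E v z \<and> E j z}" using mono i by blast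
  ultimately show ?thesis using fin by (intro psubset_card_mono) auto
qed

text \<open>If the last in-neighbour \<open>j\<close> of \<open>v\<close> dominated all
  out-neighbours of \<open>v\<close>, then \<open>{v, j}\<close> would be homogeneous; earlier
  in-neighbours have smaller counts.\<close>

lemma locally_transitive_bound:
  assumes V: "prime_on E V" "3 \<le> card V" "locally_transitive_on E V" "v \<in> V"
    and i: "i \<in> V" "E i v"
  shows "card {z \<in> V. E v z \<and> E i z} < card {z \<in> V. E v z}"
proof -
  have fin: "finite V" using V unfolding prime_on_def by blast
  have lt: "\<not> (E w a \<and> E w b \<and> E w c)" "\<not> (E a w \<and> E b w \<and> E c w)"
    if "w \<in> V" "a \<in> V" "b \<in> V" "c \<in> V" "cyc E a b c" for w a b c
    using V(3) that unfolding locally_transitive_on_def by blast+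
  define N where "N = {p \<in> V. E p v}"
  have "finite N" "N \<noteq> {}" using fin i N_def by auto
  moreover have "\<not> cyc E a b c" if "a \<in> N" "b \<in> N" "c \<in> N" for a b c
    using lt(2)[of v a b c] that V(4) unfolding N_def by blast
  ultimately obtain j where j: "j \<in> N" "\<And>t. t \<in> N \<Longrightarrow> t \<noteq> j \<Longrightarrow> E t j"
    using acyclic_sink[of N] by blast
  have jV: "j \<in> V" "E j v" using j N_def by auto
  have "{z \<in> V. E v z \<and> E j z} \<noteq> {z \<in> V. E v z}"
  proof
    assume eq: "{z \<in> V. E v z \<and> E j z} = {z \<in> V. E v z}"
    have "\<not> V \<subseteq> {v, j}" using card_mono[of "{v, j}" V] card_insert_le_m1[of 2 "{j}" v] V(2) by auto
    then obtain z where z: "z \<in> V" "z \<notin> {v, j}" by blast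
    have "v \<noteq> j" using jV by auto
    then obtain w p q where w: "w \<in> V" "w \<notin> {v, j}" "p \<in> {v, j}" "q \<in> {v, j}" "E w p" "E q w"
      using prime_onD[OF V(1), of "{v, j}" v j z] jV V(4) z by blast
    show False
    proof (cases "E v w")
      case True
      then have "E j w" using eq w by blast
      then show False using True w asym by auto
    next
      case False
      then have "E w v" using w total by blast
      then have "E w j" using j(2)[of w] w N_def by auto
      then show False using \<open>E w v\<close> w asym by auto
    qed
  qed
  then have "{z \<in> V. E v z \<and> E j z} \<subset> {z \<in> V. E v z}" by blast
  then have 1: "card {z \<in> V. E v z \<and> E j z} < card {z \<in> V. E v z}"
    using fin by (intro psubset_card_mono) auto
  show ?thesis
  proof (cases "i = j")
    case False
    then have "E i j" using j i N_def by auto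
    then show ?thesis using locally_transitive_strict_mono[OF V(1,3,4) i jV] 1 by simp
  qed (use 1 in simp)
qed

text \<open>For the proof fix \<open>v\<close> and let \<open>Out\<close>, \<open>In\<close> be its neighbourhoods, which are linearly ordered. The number \<open>g i\<close>
  of out-neighbours in \<open>Out\<close> is strictly monotone on \<open>In\<close>, and so is the dual count; comparing
  ranges, \<open>Out\<close> and \<open>In\<close> have the same size and \<open>g\<close> is the rank in \<open>In\<close>.\<close>

theorem locally_transitive_prime_circular:
  assumes V: "prime_on E V" "3 \<le> card V" "locally_transitive_on E V"
  obtains k :: nat and h :: "'a \<Rightarrow> nat" where "bij_betw h V {1..2 * k + 1}"
    "\<And>x y. x \<in> V \<Longrightarrow> y \<in> V \<Longrightarrow>
      E x y \<longleftrightarrow> h x < h y \<and> h y \<le> h x + k \<or> h y + k < h x"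
proof -
  interpret conv: tournament_rel "\<lambda>x y. E y x"
    by unfold_locales (use asym total in blast)+
  have V': "prime_on (\<lambda>x y. E y x) V" "3 \<le> card V" "locally_transitive_on (\<lambda>x y. E y x) V"
    using V by (simp_all add: prime_on_conv[of E] locally_transitive_on_conv[of E])
  have fin: "finite V" using V unfolding prime_on_def by blast
  have lt: "\<not> (E w a \<and> E w b \<and> E w c)" "\<not> (E a w \<and> E b w \<and> E c w)"
    if "w \<in> V" "a \<in> V" "b \<in> V" "c \<in> V" "cyc E a b c" for w a b c
    using V(3) that unfolding locally_transitive_on_def by blast+
  obtain v where v: "v \<in> V" using V(2) by fastforce
  define Out where "Out = {z \<in> V. E v z}"
  define In where "In = {z \<in> V. E z v}"
  define k where "k = card Out"
  define g where "g i = card {z \<in> V. E v z \<and> E i z}" for i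
  define r where "r z = card {y \<in> Out. E y z}" for z
  have finO: "finite Out" "finite In" using fin Out_def In_def by auto
  have gm: "g i < g j" if "i \<in> In" "j \<in> In" "E i j" for i j
    using locally_transitive_strict_mono[OF V(1,3) v] that unfolding In_def g_def by blast
  have gk: "g i < k" if "i \<in> In" for i
    using locally_transitive_bound[OF V v] that unfolding In_def g_def k_def Out_def by blast
  have "card {z \<in> V. E z v \<and> E z i} < card {z \<in> V. E z v \<and> E z j}"
    if "i \<in> Out" "j \<in> Out" "E j i" for i j
    using conv.locally_transitive_strict_mono[OF V'(1,3) v, of i j] that unfolding Out_def by blast
  moreover have "card {z \<in> V. E z v \<and> E z i} < card In" if "i \<in> Out" for i
    using conv.locally_transitive_bound[OF V' v, of i] that unfolding Out_def In_def by blast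
  ultimately have "k \<le> card In"
    unfolding k_def by (intro conv.strict_mono_into_lessThan(1)[OF finO(1)])
  moreover have "card In \<le> k"
    using gm gk by (intro strict_mono_into_lessThan(1)[OF finO(2)])
  ultimately have kI: "card In = k" by simp
  have gbij: "bij_betw g In {..<k}"
    using gm gk kI by (intro strict_mono_into_lessThan(2)[OF finO(2)])
  have rm: "r x < r y" if "x \<in> Out" "y \<in> Out" "E x y" for x y
    unfolding r_def
  proof (rule transitive_rank[OF finO(1) _ that])
    show "\<not> cyc E a b c" if "a \<in> Out" "b \<in> Out" "c \<in> Out" for a b c
      using lt(1)[of v a b c] that v unfolding Out_def by blast
  qed
  have rk: "r x < k" if "x \<in> Out" for x
  proof -
    have "{y \<in> Out. E y x} \<subset> Out" using that irrefl by blast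
    then show ?thesis unfolding r_def k_def using finO(1) by (rule psubset_card_mono[rotated])
  qed
  have rbij: "bij_betw r Out {..<k}"
    using rm rk by (intro strict_mono_into_lessThan(2)[OF finO(1)]) (simp_all add: k_def)
  \<comment> \<open>Otherwise the cyclic triangle \<open>v x i\<close> would dominate
    \<open>y\<close>. Hence \<open>i\<close> dominates an initial segment of \<open>Out\<close>, of
    length \<open>g i\<close>.\<close>
  have initial: "E i x" if "i \<in> In" "x \<in> Out" "y \<in> Out" "E x y" "E i y" for i x y
  proof (rule ccontr)
    assume "\<not> E i x"
    moreover have "i \<noteq> x" using that asym unfolding In_def Out_def by blast
    ultimately have "cyc E v x i" using total that unfolding In_def Out_def by blast
    then show False using lt(2)[of y v x i] that v unfolding In_def Out_def by blast
  qed
  have io: "E i x \<longleftrightarrow> r x < g i" if i: "i \<in> In" and x: "x \<in> Out" for i x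
  proof
    assume ix: "E i x"
    have "insert x {y \<in> Out. E y x} \<subseteq> {z \<in> V. E v z \<and> E i z}"
      using initial[OF i _ x _ ix] ix x unfolding Out_def by blast
    then have "card (insert x {y \<in> Out. E y x}) \<le> g i"
      unfolding g_def using fin by (intro card_mono) auto
    then show "r x < g i" unfolding r_def using finO(1) by simp
  next
    assume less: "r x < g i"
    show "E i x"
    proof (rule ccontr)
      assume no: "\<not> E i x"
      have "E z x" if "z \<in> Out" "E i z" for z
        using initial[OF i x that(1)] that total[of z x] no by metis
      then have "{z \<in> V. E v z \<and> E i z} \<subseteq> {y \<in> Out. E y x}" unfolding Out_def by blast
      then have "g i \<le> r x" unfolding g_def r_def using finO(1) by (intro card_mono) auto
      then show False using less by simp
    qed
  qed
  \<comment> \<open>Positions around the circle: \<open>v\<close> at 1, \<open>Out\<close> by rank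
    from 2 to \<open>k + 1\<close>, \<open>In\<close> by \<open>g\<close> from \<open>k + 2\<close>
    to \<open>2 * k + 1\<close>. With these offsets \<open>r x < g i\<close> in \<open>io\<close>
    reads \<open>h x + k < h i\<close>.\<close>
  define h where "h x = (if x = v then 1 else if E v x then 2 + r x else k + 2 + g x)" for x
  have hv: "h v = 1" by (simp add: h_def)
  have hO: "h x = 2 + r x" if "x \<in> Out" for x using that unfolding h_def Out_def by auto
  have hI: "h x = k + 2 + g x" if "x \<in> In" for x using that asym unfolding h_def In_def by auto
  have parts: "V = insert v (Out \<union> In)" using v total unfolding Out_def In_def by blast
  have disj: "v \<notin> Out" "v \<notin> In" "Out \<inter> In = {}" using asym unfolding Out_def In_def by auto
  have split: "x = v \<or> x \<in> Out \<or> x \<in> In" if "x \<in> V" for x using that parts by blast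
  have "bij_betw h {v} {1}" using hv by (simp add: bij_betw_def)
  moreover have "bij_betw h Out {2..<k + 2}"
  proof -
    have "bij_betw ((\<lambda>x. x + 2) \<circ> r) Out {2..<k + 2}"
      by (rule bij_betw_trans[OF rbij], rule bij_betw_byWitness[where f' = "\<lambda>x. x - 2"]) auto
    then show ?thesis using hO by (subst bij_betw_cong[where g = "(\<lambda>x. x + 2) \<circ> r"]) auto
  qed
  ultimately have "bij_betw h ({v} \<union> Out) ({1} \<union> {2..<k + 2})"
    by (rule bij_betw_combine) auto
  moreover have "bij_betw h In {k + 2..<2 * k + 2}"
  proof -
    have "bij_betw ((\<lambda>x. x + (k + 2)) \<circ> g) In {k + 2..<2 * k + 2}"
      by (rule bij_betw_trans[OF gbij], rule bij_betw_byWitness[where f' = "\<lambda>x. x - (k + 2)"]) auto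
    then show ?thesis using hI by (subst bij_betw_cong[where g = "(\<lambda>x. x + (k + 2)) \<circ> g"]) auto
  qed
  ultimately have "bij_betw h ({v} \<union> Out \<union> In) (({1} \<union> {2..<k + 2}) \<union> {k + 2..<2 * k + 2})"
    by (rule bij_betw_combine) auto
  moreover have "{v} \<union> Out \<union> In = V" using parts by auto
  moreover have "({1} \<union> {2..<k + 2}) \<union> {k + 2..<2 * k + 2} = {1..2 * k + 1}" by auto
  ultimately have bij: "bij_betw h V {1..2 * k + 1}" by simp
  have forward: "h x < h y \<and> h y \<le> h x + k \<or> h y + k < h x" if xy: "x \<in> V" "y \<in> V" "E x y" for x y
    using split[OF xy(1)] split[OF xy(2)]
  proof (elim disjE)
    assume "x = v" "y = v" then show ?thesis using xy by simp
  next
    assume "x = v" "y \<in> Out" then show ?thesis using hv hO rk by fastforce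
  next
    assume "x = v" "y \<in> In" then show ?thesis using xy asym unfolding In_def by blast
  next
    assume "x \<in> Out" "y = v" then show ?thesis using xy asym unfolding Out_def by blast
  next
    assume "x \<in> Out" "y \<in> Out" then show ?thesis using hO[of x] hO[of y] rm[of x y] rk[of y] xy by auto
  next
    assume *: "x \<in> Out" "y \<in> In"
    then have "\<not> r x < g y" using io[of y x] asym xy by blast
    then show ?thesis using hO[of x] hI[of y] rk[of x] * by auto
  next
    assume "x \<in> In" "y = v" then show ?thesis using hv hI[of x] by auto
  next
    assume *: "x \<in> In" "y \<in> Out"
    then have "r y < g x" using io[of x y] xy by blast
    then show ?thesis using hO[of y] hI[of x] * by auto
  next
    assume "x \<in> In" "y \<in> In" then show ?thesis using hI[of x] hI[of y] gm[of x y] gk[of y] xy by auto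
  qed
  have "E x y \<longleftrightarrow> h x < h y \<and> h y \<le> h x + k \<or> h y + k < h x" if xy: "x \<in> V" "y \<in> V" for x y
  proof (cases "x = y")
    case False
    have "E x y" if "h x < h y \<and> h y \<le> h x + k \<or> h y + k < h x"
    proof (rule ccontr)
      assume "\<not> E x y"
      then have "E y x" using False total by blast
      then show False using forward[OF xy(2,1)] that by auto
    qed
    then show ?thesis using forward[OF xy] by blast
  qed simp
  then show thesis using that bij by blast
qed

end

section \<open>Translation to digraphs\<close>

text \<open>An isomorphism also has to map arcs; as there are no parallel arcs, the pair of images
  of the endpoints serves as the image of an arc.\<close>

lemma digraph_iso_with_projI:
  assumes "digraph G" and f: "bij_betw f (verts G) (pverts P)"
    and arcs: "\<And>u v. u \<in> verts G \<Longrightarrow> v \<in> verts G \<Longrightarrow> u \<rightarrow>\<^bsub>G\<^esub> v \<longleftrightarrow> (f u, f v) \<in> parcs P"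
    and P: "parcs P \<subseteq> pverts P \<times> pverts P"
  shows "digraph_iso G (with_proj P)"
proof -
  interpret digraph G by fact
  have inj: "inj_on f (verts G)" and img: "f ` verts G = pverts P"
    using f by (auto simp: bij_betw_def)
  define hom where "hom = \<lparr>iso_verts = f, iso_arcs = (\<lambda>a. (f (tail G a), f (head G a))),
    iso_head = snd, iso_tail = fst\<rparr>"
  have "inj_on (\<lambda>a. (f (tail G a), f (head G a))) (arcs G)"
  proof (rule inj_onI)
    fix a b assume ab: "a \<in> arcs G" "b \<in> arcs G"
      "(f (tail G a), f (head G a)) = (f (tail G b), f (head G b))"
    then have "arc_to_ends G a = arc_to_ends G b"
      using inj by (auto simp: arc_to_ends_def dest: inj_onD)
    then show "a = b" using no_multi_arcs ab by blast
  qed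
  then have "digraph_isomorphism hom"
    using inj wf_digraph_axioms by (auto simp: digraph_isomorphism_def hom_def)
  moreover have "(\<lambda>a. (f (tail G a), f (head G a))) ` arcs G = parcs P"
  proof (intro equalityI subsetI)
    fix e assume "e \<in> (\<lambda>a. (f (tail G a), f (head G a))) ` arcs G"
    then obtain a where "a \<in> arcs G" "e = (f (tail G a), f (head G a))" by auto
    then show "e \<in> parcs P" using arcs[of "tail G a" "head G a"] by (auto intro: in_arcs_imp_in_arcs_ends)
  next
    fix e assume e: "e \<in> parcs P"
    then have "e \<in> f ` verts G \<times> f ` verts G" using P img by auto
    then obtain u v where uv: "u \<in> verts G" "v \<in> verts G" "e = (f u, f v)" by auto
    then have "u \<rightarrow>\<^bsub>G\<^esub> v" using arcs e by blast
    then obtain a where "a \<in> arcs G" "tail G a = u" "head G a = v" by auto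
    then show "e \<in> (\<lambda>a. (f (tail G a), f (head G a))) ` arcs G" using uv by auto
  qed
  then have "app_iso hom G = with_proj P"
    using img by (simp add: app_iso_def hom_def with_proj_def)
  ultimately show ?thesis unfolding digraph_iso_def by metis
qed

lemma digraph_iso_with_projD:
  assumes "digraph_iso G (with_proj P)"
  shows "\<exists>f. bij_betw f (verts G) (pverts P) \<and>
    (\<forall>u\<in>verts G. \<forall>v\<in>verts G. u \<rightarrow>\<^bsub>G\<^esub> v \<longleftrightarrow> (f u, f v) \<in> parcs P)"
proof -
  obtain hom where hom: "pre_digraph.digraph_isomorphism G hom" "with_proj P = app_iso hom G"
    using assms unfolding digraph_iso_def by blast
  interpret wf_digraph G using hom(1) unfolding pre_digraph.digraph_isomorphism_def by blast
  define f where "f = iso_verts hom"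
  have inj: "inj_on f (verts G)"
    and ends: "\<And>a. a \<in> arcs G \<Longrightarrow> iso_arcs hom a = (f (tail G a), f (head G a))"
    using hom unfolding digraph_isomorphism_def app_iso_def with_proj_def f_def
    by (auto simp: prod_eq_iff)
  have v: "pverts P = f ` verts G" and a: "parcs P = iso_arcs hom ` arcs G"
    using hom(2) by (auto simp: app_iso_def with_proj_def f_def)
  have "u \<rightarrow>\<^bsub>G\<^esub> v \<longleftrightarrow> (f u, f v) \<in> parcs P" if uv: "u \<in> verts G" "v \<in> verts G" for u v
  proof
    assume "u \<rightarrow>\<^bsub>G\<^esub> v"
    then obtain e where "e \<in> arcs G" "tail G e = u" "head G e = v" by auto
    then show "(f u, f v) \<in> parcs P" using a ends by force
  next
    assume "(f u, f v) \<in> parcs P"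
    then obtain e where e: "e \<in> arcs G" "(f u, f v) = (f (tail G e), f (head G e))"
      using a ends by force
    then have "tail G e = u" "head G e = v" using inj uv by (auto dest: inj_onD)
    then show "u \<rightarrow>\<^bsub>G\<^esub> v" using e(1) in_arcs_imp_in_arcs_ends by blast
  qed
  then show ?thesis using inj v by (intro exI[of _ f]) (simp add: bij_betw_def)
qed

lemma dominates_induce_subgraph:
  "u \<rightarrow>\<^bsub>G \<restriction> S\<^esub> v \<longleftrightarrow> u \<in> S \<and> v \<in> S \<and> u \<rightarrow>\<^bsub>G\<^esub> v"
  unfolding arcs_ends_def arc_to_ends_def by (auto simp: image_iff)

lemma U5_eq:
  "U5 = with_proj \<lparr>pverts = {1, 2, 3, 4, 5}, parcs = {(2, 1), (2, 3), (2, 4), (1, 3), (3, 4), (4, 1),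
    (5, 2), (5, 1), (3, 5), (4, 5)}\<rparr>"
proof -
  let ?P = "\<lambda>i j. {i, j} \<noteq> {1, 2::nat} \<and> (\<exists>k\<in>{1, 2}. [int j - int i = k] (mod 5))"
  have "{(i, j). i \<in> {1..5} \<and> j \<in> {1..5} \<and> ?P i j} =
      {p \<in> {1..5} \<times> {1..5}. ?P (fst p) (snd p)}"
    by (rule set_eqI) (simp only: mem_Collect_eq mem_Times_iff split_beta conj_assoc)
  also have "\<dots> = {(2, 3), (2, 4), (1, 3), (3, 4), (4, 1), (5, 2), (5, 1), (3, 5), (4, 5)}"
    by code_simp
  finally have arcs: "{(i, j). i \<in> {1..5} \<and> j \<in> {1..5} \<and> ?P i j} =
      {(2, 3), (2, 4), (1, 3), (3, 4), (4, 1), (5, 2), (5, 1), (3, 5), (4, 5)}" .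
  have "{1..5::nat} = {1, 2, 3, 4, 5}" by code_simp
  then show ?thesis unfolding U5_def arcs by simp
qed

text \<open>The arguments \<open>v a b c w\<close> stand for the vertices 2, 1, 3, 4, 5 of
  \<open>U5\<close>, in this order.\<close>

definition U5_at :: "('a \<Rightarrow> 'a \<Rightarrow> bool) \<Rightarrow> 'a \<Rightarrow> 'a \<Rightarrow> 'a \<Rightarrow> 'a \<Rightarrow> 'a \<Rightarrow> bool" where
  "U5_at E v a b c w \<longleftrightarrow> E v a \<and> E v b \<and> E v c \<and> E a b \<and> E b c \<and> E c a \<and> E w v \<and> E w a \<and> E b w \<and> E c w"

context tournament
begin

lemma U5_subtournament_iff:
  "\<not> is_free U5 G \<longleftrightarrow> (\<exists>v a b c w. {v, a, b, c, w} \<subseteq> verts G \<and> U5_at (\<lambda>x y. x \<rightarrow> y) v a b c w)"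
    (is "?L \<longleftrightarrow> ?R")
proof
  assume ?L
  then obtain S where S: "S \<subseteq> verts G" "digraph_iso (G \<restriction> S) U5" unfolding is_free_def by blast
  let ?A = "{(2, 1), (2, 3), (2, 4), (1, 3), (3, 4), (4, 1), (5, 2), (5, 1), (3, 5), (4, 5)} :: (nat \<times> nat) set"
  obtain f where "bij_betw f (verts (G \<restriction> S)) (pverts \<lparr>pverts = {1, 2, 3, 4, 5}, parcs = ?A\<rparr>)"
    and f': "\<forall>u\<in>verts (G \<restriction> S). \<forall>v\<in>verts (G \<restriction> S).
      u \<rightarrow>\<^bsub>G \<restriction> S\<^esub> v \<longleftrightarrow> (f u, f v) \<in> parcs \<lparr>pverts = {1, 2, 3, 4, 5}, parcs = ?A\<rparr>"
    using digraph_iso_with_projD[OF S(2)[unfolded U5_eq]] by (elim exE conjE)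
  then have img: "f ` S = {1, 2, 3, 4, 5}" by (simp add: bij_betw_def)
  have arc: "u \<rightarrow> v" if "u \<in> S" "v \<in> S" "(f u, f v) \<in> ?A" for u v
  proof -
    have "u \<rightarrow>\<^bsub>G \<restriction> S\<^esub> v" using f' that by simp
    then show ?thesis by (simp only: dominates_induce_subgraph)
  qed
  have ex: "\<exists>v\<in>S. f v = i" if "i \<in> {1, 2, 3, 4, 5}" for i
  proof -
    have "i \<in> f ` S" unfolding img by (rule that)
    then show ?thesis by (elim imageE) metis
  qed
  obtain v where v: "v \<in> S" "f v = 2" using ex[of 2] by auto
  obtain a where a: "a \<in> S" "f a = 1" using ex[of 1] by auto
  obtain b where b: "b \<in> S" "f b = 3" using ex[of 3] by auto
  obtain c where c: "c \<in> S" "f c = 4" using ex[of 4] by auto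
  obtain w where w: "w \<in> S" "f w = 5" using ex[of 5] by auto
  have "U5_at (\<lambda>x y. x \<rightarrow> y) v a b c w"
    unfolding U5_at_def by (intro conjI arc) (simp_all add: v a b c w)
  then show ?R using v a b c w S(1) by (intro exI[of _ v] exI[of _ a] exI[of _ b] exI[of _ c] exI[of _ w]) auto
next
  assume ?R
  then obtain v a b c w where V: "{v, a, b, c, w} \<subseteq> verts G" and U: "U5_at (\<lambda>x y. x \<rightarrow> y) v a b c w"
    by blast
  note h = U[unfolded U5_at_def]
  have asym: "\<not> y \<rightarrow> x" if "x \<rightarrow> y" for x y
    using exactly_one_arc[of x y] adj_not_same[of x] that adj_in_verts[OF that] by blast
  have n: "\<not> a \<rightarrow> v" "\<not> b \<rightarrow> v" "\<not> c \<rightarrow> v" "\<not> b \<rightarrow> a" "\<not> c \<rightarrow> b" "\<not> a \<rightarrow> c" "\<not> v \<rightarrow> w"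
    "\<not> a \<rightarrow> w" "\<not> w \<rightarrow> b" "\<not> w \<rightarrow> c"
    using h by (simp_all add: asym)
  have irr: "\<not> x \<rightarrow> x" for x using adj_not_same by blast
  have ne: "v \<noteq> a" "v \<noteq> b" "v \<noteq> c" "v \<noteq> w" "a \<noteq> b" "a \<noteq> c" "a \<noteq> w" "b \<noteq> c" "b \<noteq> w" "c \<noteq> w"
    using h n by metis+
  \<comment> \<open>The default value 5 is the image of \<open>w\<close>.\<close>
  define f where "f = (\<lambda>_. 5)(v := 2, a := 1, b := 3, c := 4 :: nat)"
  have fx: "f v = 2" "f a = 1" "f b = 3" "f c = 4" "f w = 5" using ne by (simp_all add: f_def)
  let ?S = "{v, a, b, c, w}"
  have "digraph_iso (G \<restriction> ?S) U5" unfolding U5_eq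
  proof (rule digraph_iso_with_projI)
    show "digraph (G \<restriction> ?S)" by (rule digraphI_induced[OF induced_induce[OF V]])
    have "f ` ?S = {1, 2, 3, 4, 5}" unfolding image_insert image_empty fx by auto
    moreover have "inj_on f ?S" using fx by (intro inj_onI) (elim insertE emptyE; simp)
    ultimately show "bij_betw f (verts (G \<restriction> ?S)) (pverts \<lparr>pverts = {1, 2, 3, 4, 5}, parcs = {(2, 1),
      (2, 3), (2, 4), (1, 3), (3, 4), (4, 1), (5, 2), (5, 1), (3, 5), (4, 5)}\<rparr>)"
      by (simp add: bij_betw_def)
    fix x y assume "x \<in> verts (G \<restriction> ?S)" "y \<in> verts (G \<restriction> ?S)"
    then have xy: "x \<in> ?S" "y \<in> ?S" by simp_all
    have "x \<rightarrow> y \<longleftrightarrow> (f x, f y) \<in> {(2, 1), (2, 3), (2, 4), (1, 3), (3, 4), (4, 1), (5, 2), (5, 1), (3, 5),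
      (4, 5)}"
      using xy by (elim insertE emptyE) (simp_all add: fx h n irr)
    then show "x \<rightarrow>\<^bsub>G \<restriction> ?S\<^esub> y \<longleftrightarrow> (f x, f y) \<in> parcs \<lparr>pverts = {1, 2, 3, 4, 5}, parcs = {(2, 1),
      (2, 3), (2, 4), (1, 3), (3, 4), (4, 1), (5, 2), (5, 1), (3, 5), (4, 5)}\<rparr>"
      using xy by (simp add: dominates_induce_subgraph)
  qed simp
  then show ?L using V unfolding is_free_def by blast
qed

text \<open>Extending the arc relation to the whole type frees all later statements from membership
  assumptions. The outside vertices are linearly ordered and come after \<open>G\<close>, so they lie on no cycle;
  thus no copy of \<open>U\<^sub>5\<close> or \<open>T\<^sub>5\<close>, both Hamiltonian, is created.\<close>

lemma relation_extension:
  obtains E where "tournament_rel E" "\<And>u v. u \<in> verts G \<Longrightarrow> v \<in> verts G \<Longrightarrow> E u v \<longleftrightarrow> u \<rightarrow> v"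
    "\<And>a b c d e. E a b \<Longrightarrow> E b c \<Longrightarrow> E c d \<Longrightarrow> E d e \<Longrightarrow> E e a \<Longrightarrow> {a, b, c, d, e} \<subseteq> verts G"
proof -
  obtain r :: "'a rel" where "well_order_on UNIV r" using well_order_on by blast
  then have "linear_order r" by (simp add: well_order_on_def)
  then have r: "trans r" "antisym r" "total r"
    by (auto simp: linear_order_on_def partial_order_on_def preorder_on_def)
  define E where "E u v \<longleftrightarrow> (if u \<in> verts G \<and> v \<in> verts G then u \<rightarrow> v
    else u \<in> verts G \<or> v \<notin> verts G \<and> u \<noteq> v \<and> (u, v) \<in> r)" for u v
  have irr: "\<not> u \<rightarrow> u" for u using adj_not_same by blast
  have asym: "\<not> E y x" if "E x y" for x y
    using that exactly_one_arc[of x y] irr r(2) unfolding E_def by (auto split: if_splits dest: antisymD)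
  have total: "E x y \<or> E y x" if "x \<noteq> y" for x y
    using that exactly_one_arc[of x y] r(3) unfolding E_def total_on_def by auto
  have trel: "tournament_rel E" by unfold_locales (use asym total in blast)+
  have closed: "v \<notin> verts G" if "E u v" "u \<notin> verts G" for u v
    using that unfolding E_def by (auto split: if_splits)
  have outr: "(u, v) \<in> r" "u \<noteq> v" if "E u v" "u \<notin> verts G" for u v
    using that unfolding E_def by (auto split: if_splits)
  have start: "a \<in> verts G" if h: "E a b" "E b c" "E c d" "E d e" "E e a" for a b c d e
  proof (rule ccontr)
    assume a: "a \<notin> verts G"
    note b = closed[OF h(1) a] note c = closed[OF h(2) b] note d = closed[OF h(3) c]
    note e = closed[OF h(4) d]
    have "(b, a) \<in> r"
      using outr(1)[OF h(2) b] outr(1)[OF h(3) c] outr(1)[OF h(4) d] outr(1)[OF h(5) e] r(1)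
      by (meson transD)
    then show False using outr[OF h(1) a] r(2) by (auto dest: antisymD)
  qed
  show thesis
  proof (rule that[OF trel])
    show "E u v \<longleftrightarrow> u \<rightarrow> v" if "u \<in> verts G" "v \<in> verts G" for u v
      using that by (simp add: E_def)
    show "{a, b, c, d, e} \<subseteq> verts G" if h: "E a b" "E b c" "E c d" "E d e" "E e a" for a b c d e
      using start[OF h] start[OF h(2-5,1)] start[OF h(3-5,1,2)] start[OF h(4,5,1-3)]
        start[OF h(5,1-4)] by simp
  qed
qed

end

context prime_tournament
begin

lemma prime_on_relation:
  assumes "\<And>u v. u \<in> verts G \<Longrightarrow> v \<in> verts G \<Longrightarrow> E u v \<longleftrightarrow> u \<rightarrow> v"
  shows "prime_on E (verts G)"
  unfolding prime_on_def
proof (intro conjI allI impI)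
  show "finite (verts G)" by simp
  fix I assume I: "I \<subseteq> verts G" "\<forall>v\<in>verts G - I. uniform_to E v I"
  then have "homogeneous_set G I"
    unfolding homogeneous_set_def uniform_to_def using assms by (auto simp: subset_iff)
  then have "\<not> (1 < card I \<and> card I < card (verts G))"
    using no_nontrivial_homogeneous_set by blast
  moreover have "card I < card (verts G)" if "I \<noteq> verts G"
    using I(1) that by (intro psubset_card_mono) auto
  ultimately show "card I \<le> 1 \<or> I = verts G" by linarith
qed

end

lemma T_tournament_eq:
  "T_tournament (2 * k + 1) = with_proj \<lparr>pverts = {1..2 * k + 1},
    parcs = {(i, j). i \<in> {1..2 * k + 1} \<and> j \<in> {1..2 * k + 1} \<and> (i < j \<and> j \<le> i + k \<or> j + k < i)}\<rparr>"
proof -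
  have "{(i, j). i \<in> {1..2 * k + 1} \<and> j \<in> {1..2 * k + 1} \<and>
      (\<exists>d\<in>{1..k}. [int j - int i = int d] (mod int (2 * k + 1)))} =
    {(i, j). i \<in> {1..2 * k + 1} \<and> j \<in> {1..2 * k + 1} \<and> (i < j \<and> j \<le> i + k \<or> j + k < i)}"
    using circular_arc_iff by (simp cong: conj_cong)
  moreover have "(2 * k + 1 - 1) div 2 = k" by simp
  ultimately show ?thesis unfolding T_tournament_def by (simp only:)
qed

text \<open>The out-neighbours of \<open>v\<close> are the \<open>k\<close> vertices that follow it
  on the circle, and on so short a stretch the relation is a linear order.\<close>

lemma circular_no_dominated_triangle:
  fixes v a b c k :: nat
  defines "R \<equiv> \<lambda>x y. x < y \<and> y \<le> x + k \<or> y + k < x"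
  assumes "{v, a, b, c} \<subseteq> {1..2 * k + 1}" "R v a" "R v b" "R v c" "R a b" "R b c"
  shows "\<not> R c a"
proof
  assume "R c a"
  have "v \<le> 2 * k + 1" "a \<le> 2 * k + 1" "b \<le> 2 * k + 1" "c \<le> 2 * k + 1" "1 \<le> v" "1 \<le> a" "1 \<le> b" "1 \<le> c"
    using assms(2) by auto
  with assms(3-7) \<open>R c a\<close> show False unfolding R_def by (elim disjE) linarith+
qed

section \<open>The two directions of the equivalence\<close>

context tournament
begin

text \<open>A cyclic triangle has two vertices in the same part exactly when it fits into the union
  of two parts; the parts are the colour classes.\<close>

lemma rainbow_iff_partition:
  "(\<exists>c. rainbow (\<lambda>x y. x \<rightarrow> y) (verts G) c) \<longleftrightarrow>
    (\<exists>X Y Z. X \<union> Y \<union> Z = verts G \<and> X \<inter> Y = {} \<and> Y \<inter> Z = {} \<and> Z \<inter> X = {} \<and>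
       transitive_set G (X \<union> Y) \<and> transitive_set G (Y \<union> Z) \<and> transitive_set G (Z \<union> X))"
    (is "?L \<longleftrightarrow> ?R")
proof
  assume ?L
  then obtain c where c: "rainbow (\<lambda>x y. x \<rightarrow> y) (verts G) c" by blast
  define X where "X k = {v \<in> verts G. c v = k}" for k
  have tr: "transitive_set G (X i \<union> X j)" for i j
    unfolding transitive_set_def
  proof (intro conjI notI)
    show "X i \<union> X j \<subseteq> verts G" by (auto simp: X_def)
    assume "\<exists>a\<in>X i \<union> X j. \<exists>b\<in>X i \<union> X j. \<exists>d\<in>X i \<union> X j. a \<rightarrow> b \<and> b \<rightarrow> d \<and> d \<rightarrow> a"
    then obtain a b d where "a \<in> X i \<union> X j" "b \<in> X i \<union> X j" "d \<in> X i \<union> X j" "a \<rightarrow> b" "b \<rightarrow> d" "d \<rightarrow> a"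
      by blast
    then show False using rainbowD[OF c, of a b d] by (auto simp: X_def)
  qed
  have un: "X Red \<union> X Green \<union> X Blue = verts G"
    unfolding X_def using colour.exhaust by blast
  have dis: "X Red \<inter> X Green = {}" "X Green \<inter> X Blue = {}" "X Blue \<inter> X Red = {}"
    by (auto simp: X_def)
  show ?R
    by (rule exI[of _ "X Red"], rule exI[of _ "X Green"], rule exI[of _ "X Blue"]) (intro conjI un dis tr)
next
  assume ?R
  then obtain X Y Z where un: "X \<union> Y \<union> Z = verts G"
    and dis: "X \<inter> Y = {}" "Y \<inter> Z = {}" "Z \<inter> X = {}"
    and tr: "transitive_set G (X \<union> Y)" "transitive_set G (Y \<union> Z)" "transitive_set G (Z \<union> X)"
    by (elim exE conjE)
  define c where "c v = (if v \<in> X then Red else if v \<in> Y then Green else Blue)" for v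
  have no: False if "transitive_set G S" "a \<in> S" "b \<in> S" "d \<in> S" "a \<rightarrow> b" "b \<rightarrow> d" "d \<rightarrow> a" for S a b d
    using that unfolding transitive_set_def by blast
  have "rainbow (\<lambda>x y. x \<rightarrow> y) (verts G) c"
    unfolding rainbow_def
  proof (intro ballI impI notI)
    fix a b d assume h: "a \<in> verts G" "b \<in> verts G" "d \<in> verts G" "a \<rightarrow> b \<and> b \<rightarrow> d \<and> d \<rightarrow> a"
      and eq: "c a = c b"
    have arcs: "a \<rightarrow> b" "b \<rightarrow> d" "d \<rightarrow> a" using h(4) by simp_all
    have mem: "a \<in> X \<union> Y \<union> Z" "b \<in> X \<union> Y \<union> Z" "d \<in> X \<union> Y \<union> Z"
      unfolding un by (rule h)+
    have same: "a \<in> X \<and> b \<in> X \<or> a \<in> Y \<and> b \<in> Y \<or> a \<in> Z \<and> b \<in> Z"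
      using mem(1,2) eq unfolding c_def Un_iff
      by (cases "a \<in> X"; cases "a \<in> Y"; cases "b \<in> X"; cases "b \<in> Y"; simp)
    have "d \<in> X \<or> d \<in> Y \<or> d \<in> Z" using mem(3) by simp
    with same show False
      by (elim disjE conjE)
        (use no[OF tr(1) _ _ _ arcs] no[OF tr(2) _ _ _ arcs] no[OF tr(3) _ _ _ arcs] in simp_all)
  qed
  then show ?L by blast
qed

lemma T_tournament_U5_free:
  assumes "odd n" "digraph_iso G (T_tournament n)"
  shows "is_free U5 G"
proof (rule ccontr)
  assume "\<not> is_free U5 G"
  then obtain v a b c w where V: "{v, a, b, c, w} \<subseteq> verts G" and U: "U5_at (\<lambda>x y. x \<rightarrow> y) v a b c w"
    using U5_subtournament_iff by blast
  obtain k where n: "n = 2 * k + 1" using assms(1) by (elim oddE)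
  obtain f where f: "bij_betw f (verts G) {1..2 * k + 1}"
    and arc: "\<forall>x\<in>verts G. \<forall>y\<in>verts G. x \<rightarrow> y \<longleftrightarrow> f x \<in> {1..2 * k + 1} \<and> f y \<in> {1..2 * k + 1} \<and>
      (f x < f y \<and> f y \<le> f x + k \<or> f y + k < f x)"
    using digraph_iso_with_projD[OF assms(2)[unfolded n T_tournament_eq]] by auto
  have R: "f x < f y \<and> f y \<le> f x + k \<or> f y + k < f x" if "x \<rightarrow> y" for x y
    using arc adj_in_verts[OF that] that by blast
  have sub: "{f v, f a, f b, f c} \<subseteq> {1..2 * k + 1}"
    using f V by (auto simp: bij_betw_def)
  note h = U[unfolded U5_at_def]
  have "\<not> (f c < f a \<and> f a \<le> f c + k \<or> f a + k < f c)"
    by (rule circular_no_dominated_triangle[OF sub R[of v a] R[of v b] R[of v c] R[of a b] R[of b c]])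
      (simp_all add: h)
  then show False using R[of c a] h by simp
qed

text \<open>In a copy, the cyclic triangles \<open>a b d\<close> and \<open>a b w\<close> force the
  same third colour on \<open>d\<close> and \<open>w\<close>, but these also share the cyclic
  triangle \<open>v d w\<close>.\<close>

lemma rainbow_U5_free:
  assumes "rainbow (\<lambda>x y. x \<rightarrow> y) (verts G) c"
  shows "is_free U5 G"
proof (rule ccontr)
  assume "\<not> is_free U5 G"
  then obtain v a b d w where V: "{v, a, b, d, w} \<subseteq> verts G" and U: "U5_at (\<lambda>x y. x \<rightarrow> y) v a b d w"
    using U5_subtournament_iff by blast
  note R = rainbowD[OF assms]
  have "c a \<noteq> c b \<and> c b \<noteq> c d \<and> c a \<noteq> c d" using R[of a b d] U V by (simp add: U5_at_def)
  moreover have "c a \<noteq> c b \<and> c b \<noteq> c w \<and> c a \<noteq> c w" using R[of a b w] U V by (simp add: U5_at_def)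
  moreover have "c d \<noteq> c w" using R[of v d w] U V by (simp add: U5_at_def)
  ultimately show False using colour_cases by metis
qed

end

context prime_tournament
begin

lemma U5_free_cases:
  assumes "is_free U5 G"
  shows "(\<exists>n\<ge>1. odd n \<and> digraph_iso G (T_tournament n)) \<or>
    (\<exists>c. rainbow (\<lambda>x y. x \<rightarrow> y) (verts G) c)"
proof -
  obtain E where E: "tournament_rel E"
    and arc: "\<And>u v. u \<in> verts G \<Longrightarrow> v \<in> verts G \<Longrightarrow> E u v \<longleftrightarrow> u \<rightarrow> v"
    and cycle: "\<And>a b c d e. E a b \<Longrightarrow> E b c \<Longrightarrow> E c d \<Longrightarrow> E d e \<Longrightarrow> E e a \<Longrightarrow> {a, b, c, d, e} \<subseteq> verts G"
    using relation_extension by blast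
  interpret tournament_rel E by (rule E)
  have pr: "prime_on E (verts G)" using arc by (rule prime_on_relation)
  interpret U5_free E
  proof
    fix v a b c w
    assume h: "E v a" "E v b" "E v c" "E a b" "E b c" "E c a" "E w v" "E w a" "E b w" "E c w"
    \<comment> \<open>The arcs \<open>v a b c w\<close> form a Hamiltonian cycle of the copy, which
      places it inside \<open>G\<close>.\<close>
    have V: "{v, a, b, c, w} \<subseteq> verts G" using cycle[OF h(1,4,5,10,7)] .
    then have "U5_at (\<lambda>x y. x \<rightarrow> y) v a b c w" using h by (simp add: U5_at_def arc)
    then show False using V assms U5_subtournament_iff by blast
  qed
  show ?thesis
  proof (cases "\<exists>a b c d e. T5_at E a b c d e")
    case True
    then obtain a b c d e where T: "T5_at E a b c d e" by blast
    have V: "{a, b, c, d, e} \<subseteq> verts G"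
      using cycle[of a b c d e] T unfolding T5_at_def by blast
    have "a \<noteq> b" "b \<noteq> c" "a \<noteq> c" using T irrefl unfolding T5_at_def by metis+
    then have "card {a, b, c} = 3" by simp
    then have card: "3 \<le> card (verts G)" using card_mono[OF finite_verts, of "{a, b, c}"] V by simp
    have "locally_transitive_on E (verts G)"
      unfolding locally_transitive_on_def
    proof (intro ballI impI conjI notI)
      fix v x y z assume h: "v \<in> verts G" "x \<in> verts G" "y \<in> verts G" "z \<in> verts G" "cyc E x y z"
      have s: "{v, x, y, z} \<subseteq> verts G" using h by simp
      show False if "E v x \<and> E v y \<and> E v z"
        using T5_prime_out_acyclic[OF pr T V s] that h(5) by simp
      show False if "E x v \<and> E y v \<and> E z v"
        using T5_prime_in_acyclic[OF pr T V s] that h(5) by simp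
    qed
    then obtain k :: nat and h where h: "bij_betw h (verts G) {1..2 * k + 1}"
      "\<And>x y. x \<in> verts G \<Longrightarrow> y \<in> verts G \<Longrightarrow>
        E x y \<longleftrightarrow> h x < h y \<and> h y \<le> h x + k \<or> h y + k < h x"
      using locally_transitive_prime_circular[OF pr card] by metis
    have hV: "h x \<in> {1..2 * k + 1}" if "x \<in> verts G" for x using h(1) that by (auto simp: bij_betw_def)
    have "digraph_iso G (T_tournament (2 * k + 1))"
      unfolding T_tournament_eq
    proof (rule digraph_iso_with_projI[OF digraph_axioms])
      show "u \<rightarrow> v \<longleftrightarrow> (h u, h v) \<in> parcs \<lparr>pverts = {1..2 * k + 1},
        parcs = {(i, j). i \<in> {1..2 * k + 1} \<and> j \<in> {1..2 * k + 1} \<and> (i < j \<and> j \<le> i + k \<or> j + k < i)}\<rparr>"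
        if "u \<in> verts G" "v \<in> verts G" for u v
        using arc[OF that] h(2)[OF that] hV that by simp
    qed (use h(1) in auto)
    moreover have "odd (2 * k + 1)" "1 \<le> 2 * k + 1" by simp_all
    ultimately show ?thesis by blast
  next
    case False
    interpret U5_T5_free E
      by unfold_locales (use False in \<open>unfold T5_at_def, blast\<close>)
    obtain c where "rainbow E (verts G) c" using prime_rainbow[OF pr] .
    then have "rainbow (\<lambda>x y. x \<rightarrow> y) (verts G) c" unfolding rainbow_def by (simp add: arc)
    then show ?thesis by blast
  qed
qed

end

theorem theorem1p1:
  fixes G :: "('a, 'b) pre_digraph"
  assumes "prime_tournament G"
  shows "is_free U5 G \<longleftrightarrow>
    (\<exists>n\<ge>1. odd n \<and> digraph_iso G (T_tournament n)) \<or>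
    (\<exists>X Y Z. X \<union> Y \<union> Z = verts G \<and>
       X \<inter> Y = {} \<and> Y \<inter> Z = {} \<and> Z \<inter> X = {} \<and>
       transitive_set G (X \<union> Y) \<and> transitive_set G (Y \<union> Z) \<and> transitive_set G (Z \<union> X))"
proof -
  interpret prime_tournament G by fact
  show ?thesis
    unfolding rainbow_iff_partition[symmetric]
    using U5_free_cases T_tournament_U5_free rainbow_U5_free by blast
qed

end
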